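(* Let $\Omega\subset\mathbb{R}^n$ be open, $1\le k\le n$, $V$ a distribution of $k$-planes of class $C^1$ on $\Omega$, and $T=\tau\mu$ a normal $k$-current on $\Omega$ with $\partial T=\tau'\mu'$, tangent to $V$. Then the following are equivalent: (i) $\mathrm{span}(\tau'(x))\subset V(x)$ for $\mu'$-a.e. $x$; (ii) the support of $\mu$ does not intersect $N(V)$.
   Context: A distribution of $k$-planes of class $C^1$ is a $C^1$ map $x\mapsto V(x)$ into the Grassmannian of $k$-planes. $V$ is involutive at $x$ if $[w,w'](x)\in V(x)$ for all $C^1$ vectorfields $w,w'$ tangent to $V$ (i.e. $w(y),w'(y)\in V(y)$ for all $y$), where $[w,w']=\mathrm{d}w(w')-\mathrm{d}w'(w)$; $N(V)$ is the open set of non-involutivity points. For an $h$-vector $v$, $\mathrm{span}(v)$ is the smallest subspace $W$ of $\mathbb{R}^n$ with $v\in\Lambda_h(W)$. Normal current: $T$ and $\partial T$ have finite mass; $T=\tau\mu$, $\partial T=\tau'\mu'$ with $\mu,\mu'$ finite positive measures and $\tau,\tau'$ integrable densities nonzero a.e.; $T$ tangent to $V$ means $\mathrm{span}(\tau(x))=V(x)$ for $\mu$-a.e. $x$. *)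

theory Defs
  imports "HOL-Analysis.Analysis"
begin

text \<open>Points of R^n are of type real^'n. An h-vector (or h-covector) is represented
by its family of coordinates indexed by h-tuples of indices, i.e. a function
on index lists, alternating and vanishing on lists of length different from h.\<close>

definition is_mv :: "nat \<Rightarrow> ('n list \<Rightarrow> real) \<Rightarrow> bool" where
  "is_mv h v \<longleftrightarrow> (\<forall>l. length l \<noteq> h \<longrightarrow> v l = 0) \<and>
     (\<forall>l i j. i < j \<and> j < length l \<longrightarrow> v (l[i := l ! j, j := l ! i]) = - v l)"

text \<open>Wedge product v_1 wedge ... wedge v_h of vectors: coordinates are the minors.\<close>
definition wedge :: "(real^'n) list \<Rightarrow> ('n list \<Rightarrow> real)" where
  "wedge vs l = (if length l = length vs then
      (\<Sum>p | p permutes {..<length vs}. of_int (sign p) * (\<Prod>j<length vs. (vs ! p j) $ (l ! j)))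
    else 0)"

definition Lambda :: "nat \<Rightarrow> (real^'n) set \<Rightarrow> ('n list \<Rightarrow> real) set" where
  "Lambda h W = {v. \<exists>F c. finite F \<and> F \<subseteq> {wedge vs | vs. length vs = h \<and> set vs \<subseteq> W} \<and>
                      v = (\<lambda>l. \<Sum>u\<in>F. c u * u l)}"

definition mvspan :: "nat \<Rightarrow> ('n list \<Rightarrow> real) \<Rightarrow> (real^'n) set" where
  "mvspan h v = \<Inter>{W. subspace W \<and> v \<in> Lambda h W}"

definition C1_on :: "'a::real_normed_vector set \<Rightarrow> ('a \<Rightarrow> 'b::real_normed_vector) \<Rightarrow> bool" where
  "C1_on S f \<longleftrightarrow> (\<exists>D. (\<forall>x\<in>S. (f has_derivative blinfun_apply (D x)) (at x)) \<and> continuous_on S D)"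

text \<open>C^1 distribution of k-planes on Omega: V(x) is a k-dimensional subspace and
V is C^1 as a map into the Grassmannian, the Grassmannian being identified (as usual)
with the set of orthogonal projection matrices of rank k.\<close>
definition C1_distribution :: "(real^'n) set \<Rightarrow> nat \<Rightarrow> (real^'n \<Rightarrow> (real^'n) set) \<Rightarrow> bool" where
  "C1_distribution \<Omega> k V \<longleftrightarrow>
     (\<forall>x\<in>\<Omega>. subspace (V x) \<and> dim (V x) = k) \<and>
     (\<exists>P :: real^'n \<Rightarrow> real^'n^'n. C1_on \<Omega> P \<and>
        (\<forall>x\<in>\<Omega>. \<forall>y. P x *v y \<in> V x \<and> (\<forall>z\<in>V x. orthogonal (y - P x *v y) z)))"

definition lie_bracket :: "(real^'n \<Rightarrow> real^'n) \<Rightarrow> (real^'n \<Rightarrow> real^'n) \<Rightarrow> real^'n \<Rightarrow> real^'n" where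
  "lie_bracket w w' x = frechet_derivative w (at x) (w' x) - frechet_derivative w' (at x) (w x)"

definition tangent_field :: "(real^'n) set \<Rightarrow> (real^'n \<Rightarrow> (real^'n) set) \<Rightarrow> (real^'n \<Rightarrow> real^'n) \<Rightarrow> bool" where
  "tangent_field \<Omega> V w \<longleftrightarrow> C1_on \<Omega> w \<and> (\<forall>y\<in>\<Omega>. w y \<in> V y)"

definition involutive_at :: "(real^'n) set \<Rightarrow> (real^'n \<Rightarrow> (real^'n) set) \<Rightarrow> real^'n \<Rightarrow> bool" where
  "involutive_at \<Omega> V x \<longleftrightarrow>
     (\<forall>w w'. tangent_field \<Omega> V w \<and> tangent_field \<Omega> V w' \<longrightarrow> lie_bracket w w' x \<in> V x)"

definition noninv :: "(real^'n) set \<Rightarrow> (real^'n \<Rightarrow> (real^'n) set) \<Rightarrow> (real^'n) set" where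
  "noninv \<Omega> V = {x\<in>\<Omega>. \<not> involutive_at \<Omega> V x}"

definition pd :: "'n \<Rightarrow> (real^'n \<Rightarrow> real) \<Rightarrow> real^'n \<Rightarrow> real" where
  "pd i f x = frechet_derivative f (at x) (axis i 1)"

fun iter_pd :: "'n list \<Rightarrow> (real^'n \<Rightarrow> real) \<Rightarrow> real^'n \<Rightarrow> real" where
  "iter_pd [] f = f"
| "iter_pd (i # is) f = pd i (iter_pd is f)"

definition smooth :: "(real^'n \<Rightarrow> real) \<Rightarrow> bool" where
  "smooth f \<longleftrightarrow> (\<forall>is x. iter_pd is f differentiable (at x))"

definition test_form :: "(real^'n) set \<Rightarrow> nat \<Rightarrow> (real^'n \<Rightarrow> 'n list \<Rightarrow> real) \<Rightarrow> bool" where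
  "test_form \<Omega> h \<omega> \<longleftrightarrow> (\<forall>x. is_mv h (\<omega> x)) \<and> (\<forall>l. smooth (\<lambda>x. \<omega> x l)) \<and>
     (\<exists>K. compact K \<and> K \<subseteq> \<Omega> \<and> (\<forall>x. x \<notin> K \<longrightarrow> \<omega> x = (\<lambda>_. 0)))"

definition dform :: "nat \<Rightarrow> (real^'n \<Rightarrow> 'n list \<Rightarrow> real) \<Rightarrow> real^'n \<Rightarrow> 'n list \<Rightarrow> real" where
  "dform k \<omega> x l = (if length l = k then
      (\<Sum>j<k. (-1) ^ j * pd (l ! j) (\<lambda>y. \<omega> y (take j l @ drop (Suc j) l)) x) else 0)"

definition pair :: "nat \<Rightarrow> ('n::finite list \<Rightarrow> real) \<Rightarrow> ('n list \<Rightarrow> real) \<Rightarrow> real" where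
  "pair h a b = (\<Sum>l\<in>{l. length l = h}. a l * b l) / fact h"

definition finite_measure_on :: "(real^'n) set \<Rightarrow> (real^'n) measure \<Rightarrow> bool" where
  "finite_measure_on \<Omega> M \<longleftrightarrow> sets M = sets borel \<and> finite_measure M \<and> emeasure M (UNIV - \<Omega>) = 0"

definition normal_current_repr ::
  "(real^'n::finite) set \<Rightarrow> nat \<Rightarrow> (real^'n) measure \<Rightarrow> (real^'n \<Rightarrow> 'n list \<Rightarrow> real)
     \<Rightarrow> (real^'n) measure \<Rightarrow> (real^'n \<Rightarrow> 'n list \<Rightarrow> real) \<Rightarrow> bool" where
  "normal_current_repr \<Omega> k \<mu> \<tau> \<mu>' \<tau>' \<longleftrightarrow>
     finite_measure_on \<Omega> \<mu> \<and> finite_measure_on \<Omega> \<mu>' \<and>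
     (\<forall>l. integrable \<mu> (\<lambda>x. \<tau> x l)) \<and> (\<forall>l. integrable \<mu>' (\<lambda>x. \<tau>' x l)) \<and>
     (AE x in \<mu>. is_mv k (\<tau> x) \<and> \<tau> x \<noteq> (\<lambda>_. 0)) \<and>
     (AE x in \<mu>'. is_mv (k - 1) (\<tau>' x) \<and> \<tau>' x \<noteq> (\<lambda>_. 0)) \<and>
     (\<forall>\<omega>. test_form \<Omega> (k - 1) \<omega> \<longrightarrow>
        (\<integral>x. pair k (dform k \<omega> x) (\<tau> x) \<partial>\<mu>) = (\<integral>x. pair (k - 1) (\<omega> x) (\<tau>' x) \<partial>\<mu>'))"

definition msupp :: "(real^'n) measure \<Rightarrow> (real^'n) set" where
  "msupp M = {x. \<forall>r>0. emeasure M (ball x r) > 0}"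

end

theory Submission
  imports Defs
begin

text \<open>
  Let \<open>nu\<close> run through the covector fields \<open>e_r - P e_r\<close>, which are of class C1 and span the
  annihilator of \<open>V\<close>. Testing the boundary of \<open>T\<close> with the forms \<open>\<eta> nu \<and> dx_q\<close>, which is legitimate
  after mollification, all terms in which \<open>nu\<close> is not differentiated vanish because \<open>T\<close> is tangent
  to \<open>V\<close>; hence the measure \<open>\<mu>'\<close> weighted by the contraction of \<open>\<tau>'\<close> with \<open>nu\<close> equals \<open>\<mu>\<close> weighted
  by the contraction of \<open>\<tau>\<close> with \<open>d nu\<close>. The former vanishes for all \<open>nu\<close> iff the span of \<open>\<tau>'\<close>
  lies in \<open>V\<close> almost everywhere. The latter vanishes iff \<open>d nu\<close> vanishes on \<open>V \<times> V\<close> at \<open>\<mu>\<close>-almost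
  every point, since \<open>\<tau>\<close> is a nonzero k-vector with k-dimensional span \<open>V\<close>, and this is
  involutivity by Cartan's formula. As \<open>N(V)\<close> is open, being \<open>\<mu>\<close>-null means missing the support
  of \<open>\<mu>\<close>.
\<close>

section \<open>Alternating families of coordinates\<close>

text \<open>A distribution need not have a global C1 frame, nor finitely many independent global
  defining forms. The projections \<open>P\<close> replace both: the fields \<open>P u\<close> are
  tangent and take every prescribed value of \<open>V x\<close> at \<open>x\<close>, and the n
  fields \<open>e_r - P e_r\<close>, in general linearly dependent, span the annihilator at every
  point. The measures \<open>\<mu>\<close> and \<open>\<mu>'\<close> may be mutually singular, so
  their densities are never compared pointwise. What passes from one to the other is the vanishing
  of all integrals against C1 functions with compact support in \<open>\<Omega>\<close>. The
  derivative of \<open>nu\<close> is never antisymmetrized. Contraction with the alternating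
  \<open>\<tau>\<close> sees only its antisymmetric part, and the vanishing of d nu on
  \<open>V \<times> V\<close> appears as symmetry there of the bilinear form with coefficients
  \<open>pd i nu_a\<close>. Fixing the index \<open>r\<close> and the list \<open>q\<close> yields
  countably many scalar identities, so that "almost everywhere" can be exchanged with the
  quantifiers over them.\<close>

lemma finite_lists_of_length [simp]: "finite {l :: 'n::finite list. length l = k}"
  using finite_lists_length_eq[of "UNIV :: 'n set" k] by simp

lemma sum_lists_Suc:
  fixes F :: "'a list \<Rightarrow> 'b::comm_monoid_add"
  assumes "finite B"
  shows "(\<Sum>l\<in>{l. set l \<subseteq> B \<and> length l = Suc k}. F l)
         = (\<Sum>b\<in>B. \<Sum>l\<in>{l. set l \<subseteq> B \<and> length l = k}. F (b # l))"
  unfolding sum.cartesian_product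
  by (rule sum.reindex_bij_witness[of _ "\<lambda>(b, l). b # l" "\<lambda>l. (hd l, tl l)"],
        auto simp: length_Suc_conv)

lemma sum_lists_UNIV_Suc:
  fixes F :: "'n::finite list \<Rightarrow> 'b::comm_monoid_add"
  shows "(\<Sum>l | length l = Suc k. F l) = (\<Sum>i\<in>UNIV. \<Sum>l | length l = k. F (i # l))"
  using sum_lists_Suc[of "UNIV :: 'n set" F k] by simp

text \<open>Splitting a list into its \<open>j\<close>-th entry and the rest is a bijection, so the
  sum does not depend on \<open>j\<close>. This makes all summands of an exterior derivative
  contribute equally in \<open>pair_dform\<close>.\<close>

lemma sum_lists_insert:
  fixes F :: "'n::finite \<Rightarrow> 'n list \<Rightarrow> 'b::comm_monoid_add"
  assumes "j \<le> k"
  shows "(\<Sum>l | length l = Suc k. F (l ! j) (take j l @ drop (Suc j) l))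
         = (\<Sum>i\<in>UNIV. \<Sum>l | length l = k. F i l)"
  unfolding sum.cartesian_product
  by (rule sum.reindex_bij_witness[of _ "\<lambda>(i, l). take j l @ i # drop j l"
        "\<lambda>l. (l ! j, take j l @ drop (Suc j) l)"])
     (use assms in \<open>auto simp: nth_append min_def id_take_nth_drop[symmetric]\<close>)

lemma sum_lists_permute:
  fixes F :: "'a list \<Rightarrow> 'b::comm_monoid_add"
  assumes "p permutes {..<k}"
  shows "(\<Sum>l | length l = k. F (permute_list p l)) = (\<Sum>l | length l = k. F l)"
proof (rule sum.reindex_bij_witness[of _ "permute_list (inv p)" "permute_list p"])
  fix l :: "'a list"
  assume "l \<in> {l. length l = k}"
  then have l: "length l = k" by simp
  have ip: "inv p permutes {..<k}" using assms by (rule permutes_inv)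
  show "permute_list p (permute_list (inv p) l) = l"
    by (subst permute_list_compose[symmetric]) (use assms l in \<open>auto simp: permutes_inv_o\<close>)
  show "permute_list (inv p) (permute_list p l) = l"
    by (subst permute_list_compose[symmetric]) (use ip l permutes_inv_o[OF assms] in auto)
qed simp_all

lemma permute_list_transpose:
  assumes "a < length l" "b < length l"
  shows "permute_list (Transposition.transpose a b) l = l[a := l ! b, b := l ! a]"
  by (rule nth_equalityI)
     (use assms in \<open>auto simp: permute_list_def nth_list_update Transposition.transpose_def\<close>)

text \<open>\<open>is_mv\<close> prescribes the sign for transpositions only; these generate all
  permutations, and both sides are multiplicative along the induction.\<close>

lemma is_mv_permute_list:
  assumes "is_mv k v" "p permutes {..<k}" "length l = k"
  shows "v (permute_list p l) = of_int (sign p) * v l"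
  using assms(2) finite_lessThan assms(3)
proof (induction arbitrary: l rule: permutes_induct)
  case id
  then show ?case by simp
next
  case (swap a b p)
  have "v (l[a := l ! b, b := l ! a]) = - v l"
  proof (cases "a < b")
    case True
    then show ?thesis using assms(1) swap unfolding is_mv_def by auto
  next
    case False
    then have "l[a := l ! b, b := l ! a] = l[b := l ! a, a := l ! b]" "b < a"
      using swap by (auto simp: list_update_swap)
    then show ?thesis using assms(1) swap unfolding is_mv_def by auto
  qed
  then have t: "v (permute_list (Transposition.transpose a b) l) = - v l"
    using swap by (simp add: permute_list_transpose)
  have "v (permute_list (Transposition.transpose a b \<circ> p) l)
      = v (permute_list p (permute_list (Transposition.transpose a b) l))"
    using swap by (subst permute_list_compose) auto
  also have "\<dots> = of_int (sign p) * - v l"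
    using swap t by simp
  also have "\<dots> = of_int (sign (Transposition.transpose a b \<circ> p)) * v l"
    using swap permutes_imp_permutation[OF finite_lessThan]
    by (subst sign_compose) (auto simp: sign_swap_id permutation_swap_id)
  finally show ?case .
qed

lemma is_mv_length: "is_mv k v \<Longrightarrow> length l \<noteq> k \<Longrightarrow> v l = 0"
  by (auto simp: is_mv_def)

lemma is_mv_swap:
  "is_mv k v \<Longrightarrow> i < j \<Longrightarrow> j < length l \<Longrightarrow> v (l[i := l ! j, j := l ! i]) = - v l"
  by (simp add: is_mv_def)

lemma is_mv_adjacent:
  assumes "is_mv k v"
  shows "v (xs @ b # a # ys) = - v (xs @ a # b # ys)"
proof -
  have "v ((xs @ a # b # ys)[length xs := (xs @ a # b # ys) ! Suc (length xs),
          Suc (length xs) := (xs @ a # b # ys) ! length xs]) = - v (xs @ a # b # ys)"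
    by (rule is_mv_swap[OF assms]) simp_all
  moreover have "(xs @ a # b # ys)[length xs := (xs @ a # b # ys) ! Suc (length xs),
          Suc (length xs) := (xs @ a # b # ys) ! length xs] = xs @ b # a # ys"
    by (rule nth_equalityI) (auto simp: nth_append nth_list_update nth_Cons split: nat.splits)
  ultimately show ?thesis by simp
qed

lemma is_mv_swap_front:
  "is_mv k v \<Longrightarrow> v (b # a # ys) = - v (a # b # ys)"
  using is_mv_adjacent[of k v "[]" b a ys] by simp

text \<open>Moving \<open>a\<close> to the front takes \<open>length xs\<close> adjacent swaps. The
  sign matches the one in \<open>dform\<close>.\<close>

lemma is_mv_front:
  assumes "is_mv k v"
  shows "v (xs @ a # ys) = (-1) ^ length xs * v (a # xs @ ys)"
proof (induction xs arbitrary: ys rule: rev_induct)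
  case (snoc b xs)
  have "v ((xs @ [b]) @ a # ys) = - v (xs @ a # b # ys)"
    using is_mv_adjacent[OF assms, of xs b a ys] by simp
  then show ?case using snoc[of "b # ys"] by simp
qed simp

lemma is_mv_Cons:
  assumes "is_mv (Suc k) v"
  shows "is_mv k (\<lambda>l. v (i # l))"
  unfolding is_mv_def
proof (intro conjI allI impI)
  fix l :: "'a list" and a b assume "a < b \<and> b < length l"
  then have "v ((i # l)[Suc a := (i # l) ! Suc b, Suc b := (i # l) ! Suc a]) = - v (i # l)"
    by (intro is_mv_swap[OF assms]) auto
  then show "v (i # l[a := l ! b, b := l ! a]) = - v (i # l)" by simp
qed (use assms in \<open>auto simp: is_mv_def\<close>)

section \<open>Antisymmetrization, wedge products and evaluation on vectors\<close>

text \<open>Antisymmetrization without the factor \<open>1 / fact k\<close>: it sends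
  \<open>tens vs\<close> exactly to \<open>wedge vs\<close>, and the factorial is later cancelled by
  the one in \<open>pair\<close>.\<close>

definition altsum :: "nat \<Rightarrow> ('n list \<Rightarrow> real) \<Rightarrow> 'n list \<Rightarrow> real" where
  "altsum k g l = (if length l = k then
     (\<Sum>p | p permutes {..<k}. of_int (sign p) * g (permute_list p l)) else 0)"

lemma is_mv_altsum: "is_mv k (altsum k g)"
  unfolding is_mv_def
proof (intro conjI allI impI)
  fix l :: "'a list" and a b assume ab: "a < b \<and> b < length l"
  show "altsum k g (l[a := l ! b, b := l ! a]) = - altsum k g l"
  proof (cases "length l = k")
    case True
    let ?t = "Transposition.transpose a b"
    have t: "?t permutes {..<k}" using ab True by (intro permutes_swap_id) auto
    have "altsum k g l = (\<Sum>p | p permutes {..<k}. of_int (sign (?t \<circ> p)) * g (permute_list (?t \<circ> p) l))"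
      unfolding altsum_def using True setum_permutations_compose_left[OF t] by simp
    also have "\<dots> = (\<Sum>p | p permutes {..<k}. - (of_int (sign p) * g (permute_list p (permute_list ?t l))))"
    proof (rule sum.cong)
      fix p assume "p \<in> {p. p permutes {..<k}}"
      then have p: "p permutes {..<k}" by simp
      have "sign (?t \<circ> p) = - sign p"
        using ab permutes_imp_permutation[OF finite_lessThan p]
        by (subst sign_compose) (auto simp: sign_swap_id permutation_swap_id)
      then show "of_int (sign (?t \<circ> p)) * g (permute_list (?t \<circ> p) l)
          = - (of_int (sign p) * g (permute_list p (permute_list ?t l)))"
        using p True by (subst permute_list_compose) auto
    qed simp
    finally show ?thesis
      using ab True unfolding altsum_def by (simp add: permute_list_transpose sum_negf)
  qed (simp add: altsum_def)
qed (simp add: altsum_def)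

lemma altsum_is_mv:
  assumes "is_mv k v"
  shows "altsum k v l = fact k * v l"
proof (cases "length l = k")
  case True
  have "of_int (sign p) * v (permute_list p l) = v l" if "p permutes {..<k}" for p
    using is_mv_permute_list[OF assms that True]
    by (simp flip: mult.assoc of_int_mult)
  then have "altsum k v l = (\<Sum>p | p permutes {..<k}. v l)"
    unfolding altsum_def using True by (auto intro!: sum.cong)
  then show ?thesis using card_permutations[OF _ finite_lessThan, of k k] by simp
qed (use assms in \<open>auto simp: altsum_def is_mv_def\<close>)

text \<open>The signs can be absorbed by the alternating factor \<open>t\<close>; after reindexing
  the lists, every permutation contributes the same sum.\<close>

lemma sum_altsum_mult:
  fixes t :: "'n::finite list \<Rightarrow> real"
  assumes "is_mv k t"
  shows "(\<Sum>l | length l = k. altsum k g l * t l) = fact k * (\<Sum>l | length l = k. g l * t l)"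
proof -
  have "(\<Sum>l | length l = k. altsum k g l * t l)
    = (\<Sum>l | length l = k. \<Sum>p | p permutes {..<k}. g (permute_list p l) * t (permute_list p l))"
    unfolding altsum_def
    by (auto intro!: sum.cong simp: sum_distrib_right is_mv_permute_list[OF assms])
  also have "\<dots> = (\<Sum>p | p permutes {..<k}. \<Sum>l | length l = k. g (permute_list p l) * t (permute_list p l))"
    by (rule sum.swap)
  also have "\<dots> = (\<Sum>p | p permutes {..<k}. \<Sum>l | length l = k. g l * t l)"
    by (intro sum.cong sum_lists_permute[where F = "\<lambda>l. g l * t l"]) auto
  finally show ?thesis using card_permutations[OF _ finite_lessThan, of k k] by simp
qed

definition tens :: "(real^'n) list \<Rightarrow> 'n list \<Rightarrow> real" where
  "tens vs l = (\<Prod>j<length vs. (vs ! j) $ (l ! j))"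

lemma tens_Cons: "tens (v # vs) (i # l) = v $ i * tens vs l"
  by (simp add: tens_def prod.lessThan_Suc_shift del: prod.lessThan_Suc)

lemma tens_Nil [simp]: "tens [] l = 1"
  by (simp add: tens_def)

text \<open>\<open>wedge\<close> permutes the vectors and \<open>altsum\<close> the indices. The two
  agree after passing to inverse permutations, which have the same sign.\<close>

lemma wedge_eq_altsum: "wedge vs l = altsum (length vs) (tens vs) l"
proof (cases "length l = length vs")
  case True
  have "of_int (sign (inv p)) * (\<Prod>j<length vs. vs ! inv p j $ (l ! j))
      = of_int (sign p) * tens vs (permute_list p l)" if p: "p permutes {..<length vs}" for p
  proof -
    have "(\<Prod>j<length vs. vs ! inv p j $ (l ! j))
        = (\<Prod>j<length vs. vs ! inv p (p j) $ (l ! p j))"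
      by (rule prod.permute[OF p, unfolded comp_def])
    also have "\<dots> = tens vs (permute_list p l)"
      unfolding tens_def using p True
      by (intro prod.cong) (auto simp: permute_list_nth permutes_inverses)
    finally show ?thesis
      using sign_inverse[OF permutes_imp_permutation[OF finite_lessThan p]] by simp
  qed
  then show ?thesis
    unfolding wedge_def altsum_def using True
    by (simp, subst sum_permutations_inverse) (auto intro!: sum.cong)
qed (simp add: wedge_def altsum_def)

text \<open>The value of \<open>f\<close>, read as a multilinear form, on a list of vectors.
  Recursion on the first slot suits inductions that contract one slot at a time.\<close>

fun mveval :: "('n::finite list \<Rightarrow> real) \<Rightarrow> (real^'n) list \<Rightarrow> real" where
  "mveval f [] = f []"
| "mveval f (v # vs) = (\<Sum>i\<in>UNIV. v $ i * mveval (\<lambda>l. f (i # l)) vs)"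

lemma mveval_eq: "mveval f vs = (\<Sum>l | length l = length vs. f l * tens vs l)"
proof (induction vs arbitrary: f)
  case Nil
  have "{l :: 'a list. length l = 0} = {[]}" by auto
  then show ?case by simp
next
  case (Cons v vs)
  show ?case
    by (simp only: mveval.simps Cons length_Cons sum_lists_UNIV_Suc tens_Cons sum_distrib_left)
       (simp add: mult_ac)
qed

lemma tens_permute:
  assumes "p permutes {..<length vs}" "length l = length vs"
  shows "tens (permute_list p vs) (permute_list p l) = tens vs l"
proof -
  have "tens vs l = (\<Prod>j<length vs. vs ! p j $ (l ! p j))"
    unfolding tens_def by (rule prod.permute[OF assms(1), unfolded comp_def])
  then show ?thesis
    unfolding tens_def using assms by (simp add: permute_list_nth)
qed

lemma mveval_permute:
  assumes "is_mv k f" "p permutes {..<k}" "length vs = k"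
  shows "mveval f (permute_list p vs) = of_int (sign p) * mveval f vs"
proof -
  have "mveval f (permute_list p vs)
    = (\<Sum>l | length l = k. f (permute_list p l) * tens (permute_list p vs) (permute_list p l))"
    using assms(3) unfolding mveval_eq
    by (subst sum_lists_permute[OF assms(2), where F = "\<lambda>l. f l * tens (permute_list p vs) l"]) auto
  also have "\<dots> = (\<Sum>l | length l = k. of_int (sign p) * (f l * tens vs l))"
    using assms by (intro sum.cong) (auto simp: is_mv_permute_list tens_permute)
  finally show ?thesis using assms(3) by (simp add: mveval_eq sum_distrib_left)
qed

lemma mveval_not_distinct:
  assumes "is_mv (length vs) f" "\<not> distinct vs"
  shows "mveval f vs = 0"
proof -
  obtain a b where ab: "a < b" "b < length vs" "vs ! a = vs ! b"
    using assms(2) unfolding distinct_conv_nth by (metis nat_neq_iff)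
  let ?t = "Transposition.transpose a b"
  have t: "?t permutes {..<length vs}" using ab by (intro permutes_swap_id) auto
  have "permute_list ?t vs = vs"
    using ab by (simp add: permute_list_transpose) (metis list_update_id)
  then have "mveval f vs = - mveval f vs"
    using mveval_permute[OF assms(1) t refl] ab by (simp add: sign_swap_id)
  then show ?thesis by simp
qed

lemma mveval_mset_zero:
  assumes "is_mv (length vs) f" "mset vs' = mset vs" "mveval f vs = 0"
  shows "mveval f vs' = 0"
proof -
  obtain p where "p permutes {..<length vs}" "permute_list p vs = vs'"
    using mset_eq_permutation[OF assms(2)] by blast
  then show ?thesis using mveval_permute[OF assms(1), of p vs] assms(3) by auto
qed

section \<open>Annihilators, orthonormal expansion and the span of a multivector\<close>

text \<open>Covectors are identified with vectors, so \<open>contr v\<close> is the annihilator of the span of \<open>v\<close>.\<close>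

definition contr :: "('n::finite list \<Rightarrow> real) \<Rightarrow> (real^'n) set" where
  "contr v = {a. \<forall>l. (\<Sum>i\<in>UNIV. a $ i * v (i # l)) = 0}"

lemma subspace_contr: "subspace (contr v)"
  unfolding subspace_def contr_def
  by (auto simp: distrib_right sum.distrib mult.assoc sum_distrib_left[symmetric])

lemma sum_contr: "a \<in> contr v \<Longrightarrow> (\<Sum>i\<in>UNIV. a $ i * v (i # l)) = 0"
  by (simp add: contr_def)

text \<open>Alternation exchanges the first two slots up to sign, so a covector that kills the first
  slot kills the second. This propagates tangency to the slices of \<open>v\<close>.\<close>

lemma mem_contr_second:
  assumes "is_mv k v" "a \<in> contr v"
  shows "a \<in> contr (\<lambda>l. v (i # l))"
  unfolding contr_def
proof (intro CollectI allI)
  fix l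
  have "(\<Sum>j\<in>UNIV. a $ j * v (i # j # l)) = (\<Sum>j\<in>UNIV. - (a $ j * v (j # i # l)))"
    using is_mv_adjacent[OF assms(1), of "[]" i] by (intro sum.cong) auto
  then show "(\<Sum>j\<in>UNIV. a $ j * v (i # j # l)) = 0"
    using assms(2) by (simp add: sum_negf contr_def)
qed

text \<open>Orthonormality of a basis is only needed through the projection formula.\<close>

definition onbasis :: "(real^'n) set \<Rightarrow> (real^'n) set \<Rightarrow> bool" where
  "onbasis B W \<longleftrightarrow> finite B \<and> card B = dim W \<and> B \<subseteq> W \<and>
     (\<forall>y. \<forall>w\<in>W. (y - (\<Sum>b\<in>B. (b \<bullet> y) *\<^sub>R b)) \<bullet> w = 0)"

lemma onbasis_exists:
  assumes "subspace W"
  obtains B where "onbasis B W"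
proof -
  obtain B where B: "B \<subseteq> W" "pairwise orthogonal B" "\<And>x. x \<in> B \<Longrightarrow> norm x = 1"
    "independent B" "card B = dim W" "span B = W"
    using orthonormal_basis_subspace[OF assms] by blast
  have fin: "finite B" using B(4) by (rule independent_imp_finite)
  have "(y - (\<Sum>b\<in>B. (b \<bullet> y) *\<^sub>R b)) \<bullet> w = 0" if "w \<in> W" for y w
  proof -
    have "orthogonal (y - (\<Sum>b\<in>B. (b \<bullet> y) *\<^sub>R b)) c" if c: "c \<in> B" for c
    proof -
      have "(\<Sum>b\<in>B. (b \<bullet> y) * (b \<bullet> c)) = (\<Sum>b\<in>B. if b = c then c \<bullet> y else 0)"
        using B(2,3) c
        by (intro sum.cong) (auto simp: pairwise_def orthogonal_def norm_eq_1)
      then show ?thesis using fin c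
        by (simp add: orthogonal_def inner_diff_left inner_diff_right inner_sum_left inner_sum_right inner_commute)
    qed
    then show ?thesis
      using orthogonal_to_span[of w B "y - (\<Sum>b\<in>B. (b \<bullet> y) *\<^sub>R b)"] that B(6)
      unfolding orthogonal_def by blast
  qed
  then show ?thesis using that[of B] B fin unfolding onbasis_def by auto
qed

text \<open>The component of \<open>y\<close> orthogonal to \<open>W\<close> is annihilated by
  \<open>v\<close>, so \<open>y\<close> may be replaced by its projection onto
  \<open>W\<close>.\<close>

lemma sum_onbasis_expand:
  assumes "onbasis B W" and "\<And>a. (\<forall>w\<in>W. a \<bullet> w = 0) \<Longrightarrow> a \<in> contr v"
  shows "(\<Sum>i\<in>UNIV. y $ i * v (i # l)) = (\<Sum>b\<in>B. (b \<bullet> y) * (\<Sum>i\<in>UNIV. b $ i * v (i # l)))"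
proof -
  have "y - (\<Sum>b\<in>B. (b \<bullet> y) *\<^sub>R b) \<in> contr v"
    using assms unfolding onbasis_def by blast
  from sum_contr[OF this, of l]
  have "(\<Sum>i\<in>UNIV. y $ i * v (i # l)) = (\<Sum>i\<in>UNIV. \<Sum>b\<in>B. (b \<bullet> y) * b $ i * v (i # l))"
    by (simp add: left_diff_distrib sum_subtractf sum_component sum_distrib_right)
  also have "\<dots> = (\<Sum>b\<in>B. \<Sum>i\<in>UNIV. (b \<bullet> y) * b $ i * v (i # l))"
    by (rule sum.swap)
  finally show ?thesis by (simp add: sum_distrib_left mult.assoc)
qed

lemma coord_onbasis_expand:
  assumes "onbasis B W" and "\<And>a. (\<forall>w\<in>W. a \<bullet> w = 0) \<Longrightarrow> a \<in> contr v"
  shows "v (i # l) = (\<Sum>b\<in>B. b $ i * (\<Sum>j\<in>UNIV. b $ j * v (j # l)))"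
proof -
  have "(\<Sum>j\<in>UNIV. axis i 1 $ j * v (j # l)) = (\<Sum>j\<in>UNIV. if j = i then v (i # l) else 0)"
    by (intro sum.cong) (auto simp: axis_def)
  then show ?thesis
    using sum_onbasis_expand[OF assms, of "axis i 1" l] by (simp add: inner_axis)
qed

text \<open>If the orthogonal complement of \<open>W\<close> annihilates \<open>v\<close>, every
  slot can be expanded in a basis of \<open>W\<close>; the induction treats the first slot and
  leaves the others to the slices of \<open>v\<close>.\<close>

lemma mv_expand:
  assumes "onbasis B W" "is_mv k v" and "\<And>a. (\<forall>w\<in>W. a \<bullet> w = 0) \<Longrightarrow> a \<in> contr v"
    and "length l = k"
  shows "v l = (\<Sum>bs\<in>{bs. set bs \<subseteq> B \<and> length bs = k}. mveval v bs * tens bs l)"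
  using assms(2-)
proof (induction k arbitrary: v l)
  case 0
  have "{bs. set bs \<subseteq> B \<and> length bs = 0} = {[]}" by auto
  with 0 show ?case by simp
next
  case (Suc k)
  obtain i l' where l: "l = i # l'" "length l' = k"
    using Suc.prems(3) by (auto simp: length_Suc_conv)
  let ?L = "{bs. set bs \<subseteq> B \<and> length bs = k}"
  have fin: "finite B" using assms(1) by (simp add: onbasis_def)
  have IH: "v (j # l') = (\<Sum>bs\<in>?L. mveval (\<lambda>l. v (j # l)) bs * tens bs l')" for j
    by (rule Suc.IH[OF is_mv_Cons[OF Suc.prems(1)] _ l(2)])
       (rule mem_contr_second[OF Suc.prems(1) Suc.prems(2)], auto)
  have "v l = (\<Sum>b\<in>B. b $ i * (\<Sum>j\<in>UNIV. b $ j * (\<Sum>bs\<in>?L. mveval (\<lambda>l. v (j # l)) bs * tens bs l')))"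
    unfolding l(1) by (subst coord_onbasis_expand[OF assms(1) Suc.prems(2)]) (auto simp flip: IH)
  also have "\<dots> = (\<Sum>b\<in>B. \<Sum>bs\<in>?L. mveval v (b # bs) * tens (b # bs) l)"
  proof (rule sum.cong[OF refl])
    fix b
    have "(\<Sum>j\<in>UNIV. b $ j * (\<Sum>bs\<in>?L. mveval (\<lambda>l. v (j # l)) bs * tens bs l'))
       = (\<Sum>bs\<in>?L. mveval v (b # bs) * tens bs l')"
      by (simp add: sum_distrib_left sum_distrib_right mult.assoc) (rule sum.swap)
    then show "b $ i * (\<Sum>j\<in>UNIV. b $ j * (\<Sum>bs\<in>?L. mveval (\<lambda>l. v (j # l)) bs * tens bs l'))
       = (\<Sum>bs\<in>?L. mveval v (b # bs) * tens (b # bs) l)"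
      by (simp add: l(1) tens_Cons sum_distrib_left mult_ac del: mveval.simps)
  qed
  also have "\<dots> = (\<Sum>bs\<in>{bs. set bs \<subseteq> B \<and> length bs = Suc k}. mveval v bs * tens bs l)"
    by (rule sum_lists_Suc[OF fin, symmetric])
  finally show ?case .
qed

text \<open>\<open>Lambda\<close> sums over a set of multivectors, so different lists with the same
  wedge product must first be collected into one coefficient.\<close>

lemma Lambda_sumI:
  assumes "finite I" and "\<And>i. i \<in> I \<Longrightarrow> length (w i) = k \<and> set (w i) \<subseteq> W"
  shows "(\<lambda>l. \<Sum>i\<in>I. d i * wedge (w i) l) \<in> Lambda k W"
proof -
  let ?u = "\<lambda>i. wedge (w i)"
  have "(\<Sum>i\<in>I. d i * ?u i l) = (\<Sum>u\<in>?u ` I. sum d {i \<in> I. ?u i = u} * u l)" for l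
  proof -
    have "(\<Sum>i\<in>I. d i * ?u i l) = (\<Sum>u\<in>?u ` I. \<Sum>i\<in>{i \<in> I. ?u i = u}. d i * ?u i l)"
      using assms(1) by (rule sum.image_gen)
    then show ?thesis by (simp add: sum_distrib_right)
  qed
  moreover have "?u ` I \<subseteq> {wedge vs | vs. length vs = k \<and> set vs \<subseteq> W}"
    using assms(2) by blast
  ultimately show ?thesis
    unfolding Lambda_def using assms(1)
    by (intro CollectI exI[of _ "?u ` I"] exI[of _ "\<lambda>u. sum d {i \<in> I. ?u i = u}"]) auto
qed

text \<open>In the summand of a permutation \<open>p\<close> the index \<open>i\<close> occurs only
  in the factor of \<open>vs ! p 0\<close>; summing over \<open>i\<close> produces the inner product
  of that vector with \<open>a\<close>.\<close>

lemma sum_wedge_Cons: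
  assumes "\<And>u. u \<in> set vs \<Longrightarrow> a \<bullet> u = 0"
  shows "(\<Sum>i\<in>UNIV. a $ i * wedge vs (i # l)) = 0"
proof (cases "length vs = Suc (length l)")
  case True
  have "(\<Sum>i\<in>UNIV. a $ i * (\<Prod>j<length vs. (vs ! p j) $ ((i # l) ! j))) = 0"
    if p: "p permutes {..<length vs}" for p
  proof -
    have "p 0 < length vs" using permutes_in_image[OF p, of 0] True by simp
    then have "(\<Sum>i\<in>UNIV. a $ i * (vs ! p 0) $ i) = 0"
      using assms[of "vs ! p 0"] by (simp add: inner_vec_def)
    then show ?thesis
      unfolding True prod.lessThan_Suc_shift
      by (simp flip: mult.assoc sum_distrib_right)
  qed
  moreover have "(\<Sum>i\<in>UNIV. a $ i * wedge vs (i # l)) = (\<Sum>p | p permutes {..<length vs}.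
      of_int (sign p) * (\<Sum>i\<in>UNIV. a $ i * (\<Prod>j<length vs. (vs ! p j) $ ((i # l) ! j))))"
    unfolding wedge_def using True
    by (simp add: sum_distrib_left, subst sum.swap) (simp add: mult_ac)
  ultimately show ?thesis by simp
qed (auto simp: wedge_def)

lemma Lambda_contr:
  assumes "v \<in> Lambda k W" "\<And>w. w \<in> W \<Longrightarrow> a \<bullet> w = 0"
  shows "a \<in> contr v"
proof -
  obtain F c where F: "finite F" "F \<subseteq> {wedge vs | vs. length vs = k \<and> set vs \<subseteq> W}"
    "v = (\<lambda>l. \<Sum>u\<in>F. c u * u l)"
    using assms(1) unfolding Lambda_def by auto
  have "(\<Sum>i\<in>UNIV. a $ i * u (i # l)) = 0" if "u \<in> F" for u l
    
  proof -
    obtain vs where "u = wedge vs" "set vs \<subseteq> W" using F(2) \<open>u \<in> F\<close> by blast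
    then show ?thesis using assms(2) sum_wedge_Cons[of vs a l] by auto
  qed
  moreover have "(\<Sum>i\<in>UNIV. a $ i * v (i # l)) = (\<Sum>u\<in>F. c u * (\<Sum>i\<in>UNIV. a $ i * u (i # l)))" for l
    unfolding F(3) by (simp add: sum_distrib_left, subst sum.swap) (simp add: mult_ac)
  ultimately show ?thesis by (simp add: contr_def)
qed

text \<open>\<open>mv_expand\<close> writes \<open>v\<close> through tensors of basis vectors of
  \<open>W\<close>. Antisymmetrizing multiplies \<open>v\<close> by \<open>fact k\<close> and turns
  the tensors into wedge products.\<close>

lemma contr_Lambda:
  assumes "subspace W" "is_mv k v" "\<And>a. (\<forall>w\<in>W. a \<bullet> w = 0) \<Longrightarrow> a \<in> contr v"
  shows "v \<in> Lambda k W"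
proof -
  obtain B where B: "onbasis B W" using onbasis_exists[OF assms(1)] .
  let ?L = "{bs. set bs \<subseteq> B \<and> length bs = k}"
  have fin: "finite ?L" using B by (simp add: onbasis_def finite_lists_length_eq)
  have "v l = (\<Sum>bs\<in>?L. (mveval v bs / fact k) * wedge bs l)" for l
  proof (cases "length l = k")
    case True
    have "fact k * v l = altsum k v l" using assms(2) by (simp add: altsum_is_mv)
    also have "\<dots> = (\<Sum>p | p permutes {..<k}. \<Sum>bs\<in>?L. of_int (sign p) * (mveval v bs * tens bs (permute_list p l)))"
      unfolding altsum_def using True mv_expand[OF B assms(2,3)]
      by (simp add: sum_distrib_left)
    also have "\<dots> = (\<Sum>bs\<in>?L. mveval v bs * wedge bs l)"
      by (subst sum.swap)
         (auto intro!: sum.cong simp: wedge_eq_altsum altsum_def True sum_distrib_left mult_ac)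
    finally have "v l = (\<Sum>bs\<in>?L. mveval v bs * wedge bs l) / fact k"
      by (simp add: field_simps)
    then show ?thesis by (simp add: sum_divide_distrib)
  qed (use assms(2) in \<open>auto simp: wedge_def is_mv_length\<close>)
  then have "v = (\<lambda>l. \<Sum>bs\<in>?L. (mveval v bs / fact k) * wedge bs l)" by auto
  then show ?thesis
    using Lambda_sumI[OF fin, of "\<lambda>bs. bs" k W "\<lambda>bs. mveval v bs / fact k"] B
    by (auto simp: onbasis_def)
qed

lemma orthogonal_comp_mem_iff: "a \<in> W\<^sup>\<bottom> \<longleftrightarrow> (\<forall>w\<in>W. a \<bullet> w = 0)"
  by (auto simp: orthogonal_comp_def orthogonal_def inner_commute)

text \<open>The right side is an admissible subspace by \<open>contr_Lambda\<close>. It lies in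
  every admissible \<open>W\<close>, because \<open>Lambda_contr\<close> puts the complement of
  \<open>W\<close> inside \<open>contr v\<close> and taking complements reverses the
  inclusion.\<close>

lemma mvspan_eq:
  assumes "is_mv k v"
  shows "mvspan k v = (contr v)\<^sup>\<bottom>"
proof -
  have "v \<in> Lambda k ((contr v)\<^sup>\<bottom>)"
    by (rule contr_Lambda[OF subspace_orthogonal_comp assms])
       (metis orthogonal_comp_mem_iff orthogonal_comp_self subspace_contr)
  moreover have "(contr v)\<^sup>\<bottom> \<subseteq> W" if W: "subspace W" "v \<in> Lambda k W" for W
  proof -
    have "W\<^sup>\<bottom> \<subseteq> contr v"
      using Lambda_contr[OF W(2)] by (auto simp: orthogonal_comp_mem_iff)
    then have "(contr v)\<^sup>\<bottom> \<subseteq> (W\<^sup>\<bottom>)\<^sup>\<bottom>" by (rule orthogonal_comp_anti_mono)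
    then show ?thesis using W(1) by (simp add: orthogonal_comp_self)
  qed
  ultimately show ?thesis
    unfolding mvspan_def using subspace_orthogonal_comp by blast
qed

lemma mvspan_subset_iff:
  assumes "is_mv k v" "subspace W"
  shows "mvspan k v \<subseteq> W \<longleftrightarrow> W\<^sup>\<bottom> \<subseteq> contr v"
  unfolding mvspan_eq[OF assms(1)]
  by (metis assms(2) orthogonal_comp_anti_mono orthogonal_comp_self subspace_contr)


section \<open>Contraction of a bilinear form with the first two slots of a multivector\<close>

lemma onbasis_rep:
  assumes "onbasis B W" "subspace W" "x \<in> W"
  shows "x = (\<Sum>b\<in>B. (b \<bullet> x) *\<^sub>R b)"
proof -
  let ?d = "x - (\<Sum>b\<in>B. (b \<bullet> x) *\<^sub>R b)"
  have "?d \<in> W"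
    using assms unfolding onbasis_def
    by (intro subspace_diff subspace_sum subspace_mul) auto
  then have "?d \<bullet> ?d = 0" using assms(1) unfolding onbasis_def by blast
  then show ?thesis by simp
qed

lemma bilinear_form_sum:
  fixes A :: "'n::finite \<Rightarrow> 'n \<Rightarrow> real"
  shows "(\<Sum>i\<in>UNIV. \<Sum>j\<in>UNIV. A i j * (\<Sum>b\<in>B. s b *\<^sub>R b) $ i * (\<Sum>c\<in>B. t c *\<^sub>R c) $ j)
    = (\<Sum>b\<in>B. \<Sum>c\<in>B. s b * t c * (\<Sum>i\<in>UNIV. \<Sum>j\<in>UNIV. A i j * b $ i * c $ j))"
proof -
  have "(\<Sum>i\<in>UNIV. \<Sum>j\<in>UNIV. A i j * (\<Sum>b\<in>B. s b *\<^sub>R b) $ i * (\<Sum>c\<in>B. t c *\<^sub>R c) $ j)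
    = (\<Sum>i\<in>UNIV. \<Sum>j\<in>UNIV. \<Sum>b\<in>B. \<Sum>c\<in>B. A i j * (s b * b $ i) * (t c * c $ j))"
    by (simp add: sum_component sum_distrib_left sum_distrib_right)
       (intro sum.cong refl sum.swap)
  also have "\<dots> = (\<Sum>i\<in>UNIV. \<Sum>b\<in>B. \<Sum>c\<in>B. \<Sum>j\<in>UNIV. A i j * (s b * b $ i) * (t c * c $ j))"
    by (rule sum.cong[OF refl], subst sum.swap, rule sum.cong[OF refl], rule sum.swap)
  also have "\<dots> = (\<Sum>b\<in>B. \<Sum>c\<in>B. \<Sum>i\<in>UNIV. \<Sum>j\<in>UNIV. A i j * (s b * b $ i) * (t c * c $ j))"
    by (subst sum.swap, rule sum.cong[OF refl], rule sum.swap)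
  finally show ?thesis by (simp add: sum_distrib_left mult_ac)
qed

text \<open>Expanding both slots in \<open>B\<close> shows that only the values of \<open>A\<close>
  on \<open>W \<times> W\<close> enter the contraction.\<close>

lemma contraction2_expand:
  fixes A :: "'n::finite \<Rightarrow> 'n \<Rightarrow> real"
  assumes "onbasis B W" "is_mv k v" and W: "\<And>a. (\<forall>w\<in>W. a \<bullet> w = 0) \<Longrightarrow> a \<in> contr v"
  shows "(\<Sum>i\<in>UNIV. \<Sum>j\<in>UNIV. A i j * v (i # j # q))
    = (\<Sum>b\<in>B. \<Sum>c\<in>B. (\<Sum>i\<in>UNIV. \<Sum>j\<in>UNIV. A i j * b $ i * c $ j) *
        (\<Sum>i\<in>UNIV. \<Sum>j\<in>UNIV. b $ i * (c $ j * v (i # j # q))))"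
proof -
  let ?N = "\<lambda>b c. \<Sum>i\<in>UNIV. \<Sum>j\<in>UNIV. b $ i * (c $ j * v (i # j # q))"
  have v: "v (i # j # q) = (\<Sum>b\<in>B. \<Sum>c\<in>B. b $ i * c $ j * ?N b c)" for i j
  proof -
    have "v (i # j # q) = (\<Sum>b\<in>B. b $ i * (\<Sum>i'\<in>UNIV. b $ i' * v (i' # j # q)))"
      by (rule coord_onbasis_expand[OF assms(1) W])
    also have "\<dots> = (\<Sum>b\<in>B. b $ i * (\<Sum>i'\<in>UNIV. b $ i' *
        (\<Sum>c\<in>B. c $ j * (\<Sum>j'\<in>UNIV. c $ j' * v (i' # j' # q)))))"
      by (intro sum.cong refl arg_cong2[where f = "(*)"]
            coord_onbasis_expand[OF assms(1) mem_contr_second[OF assms(2) W]])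
    also have "\<dots> = (\<Sum>b\<in>B. \<Sum>c\<in>B. b $ i * c $ j * ?N b c)"
      by (simp add: sum_distrib_left, rule sum.cong[OF refl], subst sum.swap) (simp add: mult_ac)
    finally show ?thesis .
  qed
  have "(\<Sum>i\<in>UNIV. \<Sum>j\<in>UNIV. A i j * v (i # j # q))
    = (\<Sum>i\<in>UNIV. \<Sum>j\<in>UNIV. \<Sum>b\<in>B. \<Sum>c\<in>B. A i j * b $ i * c $ j * ?N b c)"
    by (intro sum.cong refl) (subst v, simp add: sum_distrib_left mult_ac)
  also have "\<dots> = (\<Sum>i\<in>UNIV. \<Sum>b\<in>B. \<Sum>c\<in>B. \<Sum>j\<in>UNIV. A i j * b $ i * c $ j * ?N b c)"
    by (rule sum.cong[OF refl], subst sum.swap, rule sum.cong[OF refl], rule sum.swap)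
  also have "\<dots> = (\<Sum>b\<in>B. \<Sum>c\<in>B. \<Sum>i\<in>UNIV. \<Sum>j\<in>UNIV. A i j * b $ i * c $ j * ?N b c)"
    by (subst sum.swap, rule sum.cong[OF refl], rule sum.swap)
  finally show ?thesis by (simp only: sum_distrib_right)
qed

text \<open>In the basis expansion the coefficients of \<open>A\<close> are symmetric and those of
  \<open>v\<close> antisymmetric, so exchanging the two summation indices turns the sum into its
  negative.\<close>

lemma contraction2_symmetric:
  fixes A :: "'n::finite \<Rightarrow> 'n \<Rightarrow> real"
  assumes "subspace W" "is_mv k v" "\<And>a. (\<forall>w\<in>W. a \<bullet> w = 0) \<Longrightarrow> a \<in> contr v"
    and sym: "\<And>x y. x \<in> W \<Longrightarrow> y \<in> W \<Longrightarrow>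
      (\<Sum>i\<in>UNIV. \<Sum>j\<in>UNIV. A i j * x $ i * y $ j) = (\<Sum>i\<in>UNIV. \<Sum>j\<in>UNIV. A i j * y $ i * x $ j)"
  shows "(\<Sum>i\<in>UNIV. \<Sum>j\<in>UNIV. A i j * v (i # j # q)) = 0"
proof -
  obtain B where B: "onbasis B W" using onbasis_exists[OF assms(1)] .
  let ?A = "\<lambda>x y. \<Sum>i\<in>UNIV. \<Sum>j\<in>UNIV. A i j * x $ i * y $ j"
  let ?N = "\<lambda>b c. \<Sum>i\<in>UNIV. \<Sum>j\<in>UNIV. b $ i * (c $ j * v (i # j # q))"
  have N: "?N b c = - ?N c b" for b c
  proof -
    have "?N c b = (\<Sum>i\<in>UNIV. \<Sum>j\<in>UNIV. - (b $ i * (c $ j * v (i # j # q))))"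
      by (subst sum.swap, intro sum.cong refl, subst is_mv_swap_front[OF assms(2)]) simp
    then show ?thesis by (simp add: sum_negf)
  qed
  have "(\<Sum>b\<in>B. \<Sum>c\<in>B. ?A b c * ?N b c) = (\<Sum>b\<in>B. \<Sum>c\<in>B. ?A c b * ?N c b)"
    by (rule sum.swap)
  also have "\<dots> = (\<Sum>b\<in>B. \<Sum>c\<in>B. - (?A b c * ?N b c))"
  proof (intro sum.cong refl)
    fix b c assume "b \<in> B" "c \<in> B"
    then have "?A c b = ?A b c" using B by (intro sym) (auto simp: onbasis_def)
    then show "?A c b * ?N c b = - (?A b c * ?N b c)" by (subst N) simp
  qed
  finally show ?thesis
    using contraction2_expand[OF B assms(2,3), of A q] by (simp add: sum_negf)
qed

text \<open>Since \<open>B\<close> has exactly \<open>k\<close> elements, a list of \<open>k\<close>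
  members of \<open>B\<close> either repeats one or is a reordering of \<open>bs\<close>. If the
  value at \<open>bs\<close> were zero, all coefficients in \<open>mv_expand\<close> would
  vanish.\<close>

lemma mveval_basis_nonzero:
  assumes "onbasis B W" "is_mv k v" and W: "\<And>a. (\<forall>w\<in>W. a \<bullet> w = 0) \<Longrightarrow> a \<in> contr v"
    and "v \<noteq> (\<lambda>_. 0)" "set bs = B" "distinct bs" "length bs = k"
  shows "mveval v bs \<noteq> 0"
proof
  assume 0: "mveval v bs = 0"
  have "mveval v cs = 0" if cs: "set cs \<subseteq> B" "length cs = k" for cs
  proof (cases "distinct cs")
    case True
    have "set cs = B"
      using cs True assms(5-7) distinct_card by (metis List.finite_set card_subset_eq)
    then have "mset cs = mset bs"
      using True assms(5,6) set_eq_iff_mset_eq_distinct by blast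
    then show ?thesis using mveval_mset_zero[of bs v cs] 0 assms by simp
  next
    case False
    then show ?thesis using mveval_not_distinct assms(2) cs by blast
  qed
  then have "v l = 0" for l
    using mv_expand[OF assms(1,2) W] is_mv_length[OF assms(2)]
    by (cases "length l = k") auto
  then show False using assms(4) by auto
qed

text \<open>This is where simplicity of the k-vector enters, in the form that its span has
  dimension k: contracting with the remaining basis vectors isolates one coefficient of \<open>A\<close>.\<close>

lemma contraction2_zero_imp_symmetric:
  fixes A :: "'n::finite \<Rightarrow> 'n \<Rightarrow> real"
  assumes "subspace W" "dim W = k" "is_mv k v" "v \<noteq> (\<lambda>_. 0)"
    and W: "\<And>a. (\<forall>w\<in>W. a \<bullet> w = 0) \<Longrightarrow> a \<in> contr v"
    and zero: "\<And>q. (\<Sum>i\<in>UNIV. \<Sum>j\<in>UNIV. A i j * v (i # j # q)) = 0"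
    and xy: "x \<in> W" "y \<in> W"
  shows "(\<Sum>i\<in>UNIV. \<Sum>j\<in>UNIV. A i j * x $ i * y $ j) = (\<Sum>i\<in>UNIV. \<Sum>j\<in>UNIV. A i j * y $ i * x $ j)"
proof -
  obtain B where B: "onbasis B W" using onbasis_exists[OF assms(1)] .
  have fin: "finite B" and card: "card B = k" using B assms(2) by (auto simp: onbasis_def)
  let ?A = "\<lambda>x y. \<Sum>i\<in>UNIV. \<Sum>j\<in>UNIV. A i j * x $ i * y $ j"
  let ?N = "\<lambda>b c q. \<Sum>i\<in>UNIV. \<Sum>j\<in>UNIV. b $ i * (c $ j * v (i # j # q))"
  have sym: "?A b c = ?A c b" if bc: "b \<in> B" "c \<in> B" "b \<noteq> c" for b c
  proof -
    obtain r where r: "set r = B - {b, c}" "distinct r"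
      using finite_distinct_list[of "B - {b, c}"] fin by auto
    have len: "length (b # c # r) = k"
    proof -
      have "distinct (b # c # r)" using r bc by simp
      moreover have "set (b # c # r) = B" using r bc by auto
      ultimately show ?thesis using distinct_card card by metis
    qed
    have E: "mveval v (b' # c' # r) = (\<Sum>q | length q = length r. tens r q * ?N b' c' q)" for b' c'
    proof -
      have "(\<Sum>q | length q = length r. tens r q * ?N b' c' q) = (\<Sum>i\<in>UNIV. \<Sum>q | length q = length r.
          \<Sum>j\<in>UNIV. tens r q * (b' $ i * (c' $ j * v (i # j # q))))"
        by (simp only: sum_distrib_left) (rule sum.swap)
      also have "\<dots> = (\<Sum>i\<in>UNIV. \<Sum>j\<in>UNIV. \<Sum>q | length q = length r.
          tens r q * (b' $ i * (c' $ j * v (i # j # q))))"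
        by (rule sum.cong[OF refl], rule sum.swap)
      also have "\<dots> = mveval v (b' # c' # r)"
        by (simp only: mveval.simps, simp only: mveval_eq) (simp add: sum_distrib_left mult_ac)
      finally show ?thesis by (rule sym)
    qed
    \<comment> \<open>Weighting the vanishing contractions with \<open>tens r q\<close> and summing
      over \<open>q\<close> fills the remaining slots of \<open>v\<close> with the vectors of
      \<open>r\<close>.\<close>
    have "0 = (\<Sum>q | length q = length r. tens r q * (\<Sum>i\<in>UNIV. \<Sum>j\<in>UNIV. A i j * v (i # j # q)))"
      by (simp add: zero)
    also have "\<dots> = (\<Sum>q | length q = length r. \<Sum>b'\<in>B. \<Sum>c'\<in>B. ?A b' c' * (tens r q * ?N b' c' q))"
      by (subst contraction2_expand[OF B assms(3) W], assumption)
         (simp only: sum_distrib_left[of "tens _ _"] mult.left_commute[of "tens _ _"])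
    also have "\<dots> = (\<Sum>b'\<in>B. \<Sum>c'\<in>B. ?A b' c' * mveval v (b' # c' # r))"
      by (subst sum.swap, rule sum.cong[OF refl], subst sum.swap) (simp only: E sum_distrib_left)
    also have "\<dots> = (\<Sum>(b', c')\<in>B \<times> B. ?A b' c' * mveval v (b' # c' # r))"
      by (rule sum.cartesian_product)
    \<comment> \<open>\<open>r\<close> lists all of \<open>B\<close> except \<open>b\<close> and
      \<open>c\<close>, so for any other pair \<open>(b', c')\<close> the list
      \<open>b' # c' # r\<close> repeats a vector.\<close>
    also have "\<dots> = (\<Sum>(b', c')\<in>{(b, c), (c, b)}. ?A b' c' * mveval v (b' # c' # r))"
    proof (rule sum.mono_neutral_right)
      have z: "mveval v (b' # c' # r) = 0" if "b' \<in> B" "c' \<in> B" "(b', c') \<noteq> (b, c)" "(b', c') \<noteq> (c, b)" for b' c'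
      proof (rule mveval_not_distinct)
        show "is_mv (length (b' # c' # r)) v" using assms(3) len by simp
        show "\<not> distinct (b' # c' # r)" using that r(1) by auto
      qed
      show "\<forall>i\<in>B \<times> B - {(b, c), (c, b)}. (case i of (b', c') \<Rightarrow> ?A b' c' * mveval v (b' # c' # r)) = 0"
      proof
        fix i assume i: "i \<in> B \<times> B - {(b, c), (c, b)}"
        obtain b' c' where "i = (b', c')" by (cases i)
        with i z[of b' c'] show "(case i of (b', c') \<Rightarrow> ?A b' c' * mveval v (b' # c' # r)) = 0"
          by (simp del: mveval.simps)
      qed
    qed (use fin bc in auto)
    also have "\<dots> = ?A b c * mveval v (b # c # r) + ?A c b * mveval v (c # b # r)"
      using bc by (simp del: mveval.simps)
    also have "mveval v (c # b # r) = - mveval v (b # c # r)"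
    proof -
      have "mveval v (c # b # r) = (\<Sum>i\<in>UNIV. \<Sum>j\<in>UNIV. b $ i * (c $ j * mveval (\<lambda>l. v (j # i # l)) r))"
        by (simp add: sum_distrib_left, subst sum.swap) (simp add: mult_ac)
      also have "\<dots> = (\<Sum>i\<in>UNIV. \<Sum>j\<in>UNIV. - (b $ i * (c $ j * mveval (\<lambda>l. v (i # j # l)) r)))"
      proof -
        have "mveval (\<lambda>l. v (j # i # l)) r = - mveval (\<lambda>l. v (i # j # l)) r" for i j
          by (simp add: mveval_eq sum_negf is_mv_swap_front[OF assms(3), of j i])
        then show ?thesis by (intro sum.cong refl) (metis mult_minus_right)
      qed
      finally show ?thesis by (simp add: sum_negf sum_distrib_left)
    qed
    finally have "(?A b c - ?A c b) * mveval v (b # c # r) = 0"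
      by (simp add: left_diff_distrib del: mveval.simps)
    moreover have "mveval v (b # c # r) \<noteq> 0"
      using mveval_basis_nonzero[OF B assms(3) W assms(4) _ _ len] r bc by auto
    ultimately show ?thesis by simp
  qed
  have expand: "?A u w = (\<Sum>b\<in>B. \<Sum>c\<in>B. (b \<bullet> u) * (c \<bullet> w) * ?A b c)" if "u \<in> W" "w \<in> W" for u w
    using bilinear_form_sum[of A "\<lambda>b. b \<bullet> u" B "\<lambda>c. c \<bullet> w"]
    by (simp only: onbasis_rep[OF B assms(1) that(1), symmetric] onbasis_rep[OF B assms(1) that(2), symmetric])
  have "?A x y = (\<Sum>b\<in>B. \<Sum>c\<in>B. (b \<bullet> x) * (c \<bullet> y) * ?A b c)"
    by (rule expand[OF xy])
  also have "\<dots> = (\<Sum>b\<in>B. \<Sum>c\<in>B. (b \<bullet> x) * (c \<bullet> y) * ?A c b)"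
  proof (intro sum.cong refl)
    fix b c assume "b \<in> B" "c \<in> B"
    then show "(b \<bullet> x) * (c \<bullet> y) * ?A b c = (b \<bullet> x) * (c \<bullet> y) * ?A c b"
      using sym[of b c] by (cases "b = c") auto
  qed
  also have "\<dots> = (\<Sum>c\<in>B. \<Sum>b\<in>B. (c \<bullet> y) * (b \<bullet> x) * ?A c b)"
    by (subst sum.swap) (simp only: mult_ac)
  also have "\<dots> = ?A y x"
    by (rule expand[OF xy(2,1), symmetric])
  finally show ?thesis .
qed

section \<open>Mollification\<close>

text \<open>The functions p(1/t) exp(-1/t), extended by zero. Carrying the polynomial along makes
  the family closed under differentiation, so derivatives of all orders at 0 are handled at
  once.\<close>

definition flat :: "real poly \<Rightarrow> real \<Rightarrow> real" where
  "flat p t = (if t > 0 then poly p (1 / t) * exp (- (1 / t)) else 0)"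

lemma poly_exp_neg_tendsto_0: "((\<lambda>u. poly p u * exp (- u)) \<longlongrightarrow> 0) (at_top :: real filter)"
proof -
  have "((\<lambda>u. \<Sum>i\<le>degree p. coeff p i * (u ^ i / exp u)) \<longlongrightarrow> (\<Sum>i\<le>degree p. coeff p i * 0)) (at_top :: real filter)"
    by (intro tendsto_intros tendsto_power_div_exp_0)
  then show ?thesis
    by (simp add: poly_altdef exp_minus sum_distrib_right divide_inverse mult.assoc)
qed

lemma flat_tendsto_0: "(flat p \<longlongrightarrow> 0) (at 0)"
proof (rule filterlim_split_at)
  show "(flat p \<longlongrightarrow> 0) (at_left 0)"
    by (rule tendsto_eventually) (auto simp: eventually_at_filter flat_def)
  have "((\<lambda>t. poly p (inverse t) * exp (- inverse t)) \<longlongrightarrow> 0) (at_right 0)"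
    by (rule filterlim_compose[OF poly_exp_neg_tendsto_0 filterlim_inverse_at_top_right])
  then show "(flat p \<longlongrightarrow> 0) (at_right 0)"
    by (rule filterlim_cong[THEN iffD1, rotated -1])
       (auto simp: eventually_at_filter flat_def field_simps)
qed

text \<open>With u = 1/t one has u' = -u^2, and differentiating p(u) exp(-u) gives u^2 (p(u) -
  p'(u)) exp(-u); this is the new polynomial.\<close>

lemma DERIV_flat: "(flat p has_field_derivative flat ([:0, 0, 1:] * (p - pderiv p)) t) (at t)"
proof -
  consider "t < 0" | "t = 0" | "t > 0" by linarith
  then show ?thesis
  proof cases
    case 1
    have "((\<lambda>t. 0) has_field_derivative 0) (at t)" by simp
    then have "(flat p has_field_derivative 0) (at t)"
      by (rule has_field_derivative_transform_within_open[of _ _ _ "{..<0}"])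
         (use 1 in \<open>auto simp: flat_def\<close>)
    then show ?thesis using 1 by (simp add: flat_def)
  next
    case 2
    \<comment> \<open>The difference quotient at 0 is again of the form \<open>flat\<close>, with
      the polynomial multiplied by u, and hence tends to 0.\<close>
    have "((\<lambda>h. flat p h / h) \<longlongrightarrow> 0) (at 0)"
      by (rule filterlim_cong[THEN iffD1, OF refl refl _ flat_tendsto_0[of "[:0, 1:] * p"]])
         (auto simp: eventually_at_filter flat_def)
    then show ?thesis using 2 by (simp add: DERIV_def flat_def)
  next
    case 3
    have "((\<lambda>t. poly p (1 / t) * exp (- (1 / t))) has_field_derivative
        flat ([:0, 0, 1:] * (p - pderiv p)) t) (at t)"
      using 3 by (auto intro!: derivative_eq_intros poly_DERIV[THEN DERIV_chain2]
          simp: flat_def field_simps power2_eq_square)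
    then show ?thesis
      by (rule has_field_derivative_transform_within_open[of _ _ _ "{0<..}"])
         (use 3 in \<open>auto simp: flat_def\<close>)
  qed
qed

text \<open>This class contains all partial derivatives of its members, so these are smooth.\<close>

inductive bump :: "(real^'n::finite \<Rightarrow> real) \<Rightarrow> bool" where
  bump_const: "bump (\<lambda>x. c)"
| bump_flat: "bump (\<lambda>x. flat p (c + s * x $ i))"
| bump_add: "bump f \<Longrightarrow> bump g \<Longrightarrow> bump (\<lambda>x. f x + g x)"
| bump_mult: "bump f \<Longrightarrow> bump g \<Longrightarrow> bump (\<lambda>x. f x * g x)"

lemma bump_deriv:
  fixes g :: "real^'n::finite \<Rightarrow> real"
  assumes "bump g"
  shows "\<exists>G. (\<forall>i. bump (G i)) \<and> (\<forall>x. (g has_derivative (\<lambda>h. \<Sum>i\<in>UNIV. h $ i * G i x)) (at x))"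
  using assms
proof induction
  case (bump_const c)
  show ?case by (rule exI[of _ "\<lambda>_ _. 0"]) (auto intro: bump.bump_const)
next
  case (bump_flat p c s i)
  let ?q = "[:0, 0, 1:] * (p - pderiv p)"
  let ?G = "\<lambda>j x. (if j = i then s else 0) * flat ?q (c + s * x $ i)"
  have "((\<lambda>x. flat p (c + s * x $ i)) has_derivative (\<lambda>h. \<Sum>j\<in>UNIV. h $ j * ?G j x)) (at x)" for x :: "real^'n"
  proof -
    have "((\<lambda>x. c + s * x $ i) has_derivative (\<lambda>h. s * h $ i)) (at x)"
      by (auto intro!: derivative_eq_intros bounded_linear_imp_has_derivative bounded_linear_vec_nth)
    from has_derivative_compose[OF this DERIV_flat[of p, unfolded has_field_derivative_def]]
    have "((\<lambda>x. flat p (c + s * x $ i)) has_derivative (\<lambda>h. flat ?q (c + s * x $ i) * (s * h $ i))) (at x)" .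
    moreover have "(\<Sum>j\<in>UNIV. h $ j * ?G j x) = flat ?q (c + s * x $ i) * (s * h $ i)" for h :: "real^'n"
    proof -
      have "(\<Sum>j\<in>UNIV. h $ j * ?G j x) = (\<Sum>j\<in>UNIV. if j = i then flat ?q (c + s * x $ i) * (s * h $ i) else 0)"
        by (intro sum.cong) auto
      then show ?thesis by simp
    qed
    ultimately show ?thesis by simp
  qed
  then show ?case
    by (intro exI[of _ ?G] conjI allI) (rule bump.bump_mult bump.bump_const bump.bump_flat)+
next
  case (bump_add f g)
  then obtain F G where FG: "\<And>i. bump (F i)" "\<And>i. bump (G i)"
    "\<And>x. (f has_derivative (\<lambda>h. \<Sum>i\<in>UNIV. h $ i * F i x)) (at x)"
    "\<And>x. (g has_derivative (\<lambda>h. \<Sum>i\<in>UNIV. h $ i * G i x)) (at x)" by blast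
  show ?case
  proof (intro exI[of _ "\<lambda>i x. F i x + G i x"] conjI allI)
    fix x
    show "((\<lambda>x. f x + g x) has_derivative (\<lambda>h. \<Sum>i\<in>UNIV. h $ i * (F i x + G i x))) (at x)"
      using has_derivative_add[OF FG(3,4)] by (simp add: distrib_left sum.distrib)
  qed (intro bump.bump_add FG)
next
  case (bump_mult f g)
  then obtain F G where FG: "\<And>i. bump (F i)" "\<And>i. bump (G i)"
    "\<And>x. (f has_derivative (\<lambda>h. \<Sum>i\<in>UNIV. h $ i * F i x)) (at x)"
    "\<And>x. (g has_derivative (\<lambda>h. \<Sum>i\<in>UNIV. h $ i * G i x)) (at x)" by blast
  show ?case
  proof (intro exI[of _ "\<lambda>i x. f x * G i x + F i x * g x"] conjI allI)
    fix x
    have "(\<Sum>i\<in>UNIV. h $ i * (f x * G i x + F i x * g x)) =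
       f x * (\<Sum>i\<in>UNIV. h $ i * G i x) + (\<Sum>i\<in>UNIV. h $ i * F i x) * g x" for h
      by (simp add: distrib_left sum.distrib sum_distrib_left sum_distrib_right mult_ac)
    then show "((\<lambda>x. f x * g x) has_derivative (\<lambda>h. \<Sum>i\<in>UNIV. h $ i * (f x * G i x + F i x * g x))) (at x)"
      using has_derivative_mult[OF FG(3,4)] by simp
  qed (intro bump.bump_add bump.bump_mult bump_mult FG)
qed

lemma has_derivative_imp_continuous_on:
  "(\<And>x. (f has_derivative f' x) (at x)) \<Longrightarrow> continuous_on S f"
  by (intro continuous_at_imp_continuous_on ballI has_derivative_continuous)

lemma bump_continuous:
  assumes "bump g"
  shows "continuous_on S g"
proof -
  obtain G where "\<And>x. (g has_derivative (\<lambda>h. \<Sum>i\<in>UNIV. h $ i * G i x)) (at x)"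
    using bump_deriv[OF assms] by blast
  then show ?thesis by (rule has_derivative_imp_continuous_on)
qed

lemma bump_prod:
  "finite I \<Longrightarrow> (\<And>i. i \<in> I \<Longrightarrow> bump (f i)) \<Longrightarrow> bump (\<lambda>x. \<Prod>i\<in>I. f i x)"
  by (induction rule: finite_induct) (auto intro: bump_const bump_mult)

lemma pd_eq:
  assumes "(f has_derivative f') (at x)"
  shows "pd i f x = f' (axis i 1)"
  unfolding pd_def using frechet_derivative_at[OF assms] by simp

text \<open>Used with \<open>P\<close> the class of convolutions of one fixed function with members
  of \<open>bump\<close>: differentiating changes only the second factor.\<close>

lemma smooth_coinduct:
  assumes "P f" and "\<And>f x. P f \<Longrightarrow> f differentiable (at x)" and "\<And>f i. P f \<Longrightarrow> P (pd i f)"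
  shows "smooth f"
proof -
  have "P (iter_pd is f)" for "is"
    by (induction "is") (use assms in auto)
  then show ?thesis using assms(2) by (auto simp: smooth_def)
qed

lemma smooth_pd: "smooth f \<Longrightarrow> smooth (pd i f)"
proof -
  assume s: "smooth f"
  have "iter_pd is (pd i f) = iter_pd (is @ [i]) f" for "is"
    by (induction "is") auto
  then show ?thesis using s by (simp add: smooth_def)
qed

lemma smooth_continuous: "smooth f \<Longrightarrow> continuous_on S f"
  unfolding smooth_def
  by (metis continuous_at_imp_continuous_on differentiable_imp_continuous_within iter_pd.simps(1))

section \<open>Convolution with bump functions\<close>

text \<open>The integral runs over a fixed box and \<open>x\<close> occurs only in \<open>g\<close>,
  so the Leibniz rule puts all derivatives on \<open>g\<close> while \<open>u\<close> is merely
  continuous.\<close>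

definition convolve :: "real^'n::finite \<Rightarrow> real^'n \<Rightarrow> (real^'n \<Rightarrow> real) \<Rightarrow> (real^'n \<Rightarrow> real) \<Rightarrow> real^'n \<Rightarrow> real" where
  "convolve a b u g x = integral (cbox a b) (\<lambda>z. u z * g (x - z))"

lemma convolve_deriv:
  fixes u :: "real^'n::finite \<Rightarrow> real"
  assumes u: "continuous_on (cbox a b) u" and G: "\<And>i. bump (G i)"
    and g: "\<And>x. (g has_derivative (\<lambda>h. \<Sum>i\<in>UNIV. h $ i * G i x)) (at x)"
  shows "convolve a b u g differentiable (at x)" and "pd i (convolve a b u g) x = convolve a b u (G i) x"
proof -
  let ?D = "\<lambda>x z. \<Sum>i\<in>UNIV. (u z * G i (x - z)) *\<^sub>R (blinfun_inner_right (axis i 1) :: (real^'n) \<Rightarrow>\<^sub>L real)"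
  have D: "blinfun_apply (?D x z) h = u z * (\<Sum>i\<in>UNIV. h $ i * G i (x - z))" for x z h
    by (simp add: blinfun.sum_left blinfun.scaleR_left inner_axis' sum_distrib_left mult_ac)
  have gc: "continuous_on S g" for S
    using g by (rule has_derivative_imp_continuous_on)
  have cD: "continuous_on (UNIV \<times> cbox a b) (\<lambda>(x, z). ?D x z)"
    unfolding case_prod_beta
    by (intro continuous_intros continuous_on_compose2[OF u] continuous_on_compose2[OF bump_continuous[OF G]]) auto
  have *: "(convolve a b u g has_derivative integral (cbox a b) (?D x)) (at x)" for x
    unfolding convolve_def[abs_def]
  proof (rule leibniz_rule[where U = UNIV, simplified])
    fix x t
    have "((\<lambda>x. g (x - t)) has_derivative (\<lambda>h. \<Sum>i\<in>UNIV. h $ i * G i (x - t))) (at x)"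
      by (rule has_derivative_compose[OF _ g]) (auto intro!: derivative_eq_intros)
    from has_derivative_mult_right[OF this, of "u t"]
    show "((\<lambda>x. u t * g (x - t)) has_derivative blinfun_apply (?D x t)) (at x)"
      by (subst D[abs_def]) simp
  next
    fix x
    show "(\<lambda>z. u z * g (x - z)) integrable_on cbox a b"
      by (intro integrable_continuous continuous_intros u continuous_on_compose2[OF gc]) auto
  qed (use cD in auto)
  show "convolve a b u g differentiable (at x)" using * unfolding differentiable_def by blast
  have "?D x integrable_on cbox a b"
    by (intro integrable_continuous continuous_intros u continuous_on_compose2[OF bump_continuous[OF G]]) auto
  then have "blinfun_apply (integral (cbox a b) (?D x)) (axis i 1)
      = integral (cbox a b) (\<lambda>z. blinfun_apply (?D x z) (axis i 1))"
    by (rule blinfun_apply_integral)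
  also have "\<dots> = convolve a b u (G i) x"
  proof -
    have "(\<Sum>j\<in>UNIV. axis i 1 $ j * G j y) = (\<Sum>j\<in>UNIV. if j = i then G i y else 0)" for y
      by (intro sum.cong) (auto simp: axis_def)
    then show ?thesis unfolding D convolve_def by simp
  qed
  finally show "pd i (convolve a b u g) x = convolve a b u (G i) x"
    using pd_eq[OF *] by simp
qed

lemma smooth_convolve:
  assumes u: "continuous_on (cbox a b) u" and "bump g"
  shows "smooth (convolve a b u g)"
proof (rule smooth_coinduct[where P = "\<lambda>f. \<exists>g. bump g \<and> f = convolve a b u g"])
  fix f x assume "\<exists>g. bump g \<and> f = convolve a b u g"
  then obtain g where g: "bump g" "f = convolve a b u g" by blast
  obtain G where "\<And>i. bump (G i)" "\<And>x. (g has_derivative (\<lambda>h. \<Sum>i\<in>UNIV. h $ i * G i x)) (at x)"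
    using bump_deriv[OF g(1)] by blast
  then show "f differentiable (at x)" unfolding g(2) by (rule convolve_deriv(1)[OF u])
next
  fix f i assume "\<exists>g. bump g \<and> f = convolve a b u g"
  then obtain g where g: "bump g" "f = convolve a b u g" by blast
  obtain G where G: "\<And>i. bump (G i)" "\<And>x. (g has_derivative (\<lambda>h. \<Sum>i\<in>UNIV. h $ i * G i x)) (at x)"
    using bump_deriv[OF g(1)] by blast
  then have "pd i f = convolve a b u (G i)"
    unfolding g(2) by (intro ext convolve_deriv(2)[OF u])
  then show "\<exists>g. bump g \<and> pd i f = convolve a b u g" using G(1) by blast
qed (use assms in auto)

section \<open>The mollifier and its approximation properties\<close>

abbreviation unit_cube :: "(real^'n::finite) set" where
  "unit_cube \<equiv> cbox (\<chi> i. -1) (\<chi> i. 1)"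

text \<open>Positive exactly on the open unit cube. A cube rather than a ball keeps it a product of
  \<open>flat\<close> functions of single coordinates; the factors \<open>1\<close> and
  \<open>-1\<close> fit the form of \<open>bump_flat\<close>.\<close>

definition mollifier0 :: "real^'n::finite \<Rightarrow> real" where
  "mollifier0 y = (\<Prod>i\<in>UNIV. flat 1 (1 + 1 * y $ i) * flat 1 (1 + (-1) * y $ i))"

definition mollifier :: "real^'n::finite \<Rightarrow> real" where
  "mollifier y = mollifier0 y / integral unit_cube (mollifier0 :: real^'n \<Rightarrow> real)"

lemma flat_1: "flat 1 t \<ge> 0" "flat 1 t = 0 \<longleftrightarrow> t \<le> 0"
  by (auto simp: flat_def)

lemma mollifier0_scaled_bump: "bump (\<lambda>y. mollifier0 (m *\<^sub>R y))"
proof -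
  have "bump (\<lambda>y :: real^'n. \<Prod>i\<in>UNIV. flat 1 (1 + m * y $ i) * flat 1 (1 + (- m) * y $ i))"
    by (intro bump_prod bump_mult bump_flat) auto
  then show ?thesis by (simp add: mollifier0_def)
qed

lemma mollifier_scaled_bump: "bump (\<lambda>y :: real^'n::finite. c * mollifier (m *\<^sub>R y))"
  using bump_mult[OF bump_const[of "c / integral unit_cube (mollifier0 :: real^'n \<Rightarrow> real)"] mollifier0_scaled_bump[of m]]
  by (simp add: mollifier_def)

lemma mollifier_bump: "bump mollifier"
  using mollifier_scaled_bump[of 1 1] by simp

lemma mollifier0_nonneg: "mollifier0 y \<ge> 0"
  unfolding mollifier0_def by (intro prod_nonneg mult_nonneg_nonneg ballI flat_1)

lemma mollifier0_integral_pos: "integral unit_cube (mollifier0 :: real^'n::finite \<Rightarrow> real) > 0"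
proof -
  have c: "continuous_on unit_cube (mollifier0 :: real^'n \<Rightarrow> real)"
    using bump_continuous[OF mollifier0_scaled_bump[of 1]] by simp
  have "integral unit_cube (mollifier0 :: real^'n \<Rightarrow> real) \<noteq> 0"
  proof
    assume "integral unit_cube (mollifier0 :: real^'n \<Rightarrow> real) = 0"
    then have "(mollifier0 has_integral 0) (unit_cube :: (real^'n) set)"
      using integrable_integral[OF integrable_continuous[OF c]] by simp
    then have "mollifier0 (0 :: real^'n) = 0"
    proof (rule has_integral_0_cbox_imp_0[OF c mollifier0_nonneg])
      show "box (\<chi> i. -1) (\<chi> i. 1) \<noteq> ({} :: (real^'n) set)"
        by (auto simp: box_ne_empty Basis_vec_def inner_axis)
      show "(0 :: real^'n) \<in> unit_cube" by (simp add: mem_box_cart)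
    qed
    then show False by (simp add: mollifier0_def flat_1)
  qed
  moreover have "integral unit_cube (mollifier0 :: real^'n \<Rightarrow> real) \<ge> 0"
    by (intro integral_nonneg integrable_continuous c mollifier0_nonneg)
  ultimately show ?thesis by simp
qed

lemma mollifier_nonneg: "mollifier y \<ge> 0"
  unfolding mollifier_def by (intro divide_nonneg_nonneg mollifier0_nonneg less_imp_le mollifier0_integral_pos)

lemma mollifier_zero: "y \<notin> unit_cube \<Longrightarrow> mollifier y = 0"
proof -
  assume "y \<notin> unit_cube"
  then obtain i where "\<not> (- 1 \<le> y $ i \<and> y $ i \<le> 1)"
    unfolding mem_box_cart by auto
  then have "flat 1 (1 + 1 * y $ i) * flat 1 (1 + (-1) * y $ i) = 0" by (auto simp: flat_1)
  then show ?thesis unfolding mollifier_def mollifier0_def by (subst prod_zero) auto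
qed

lemma mollifier_integral: "((mollifier :: real^'n::finite \<Rightarrow> real) has_integral 1) unit_cube"
proof -
  have "continuous_on unit_cube (mollifier0 :: real^'n \<Rightarrow> real)"
    using bump_continuous[OF mollifier0_scaled_bump[of 1]] by simp
  then have "((\<lambda>y. mollifier0 y / integral unit_cube (mollifier0 :: real^'n \<Rightarrow> real)) has_integral
      integral unit_cube (mollifier0 :: real^'n \<Rightarrow> real) / integral unit_cube (mollifier0 :: real^'n \<Rightarrow> real)) (unit_cube :: (real^'n) set)"
    by (intro has_integral_divide integrable_integral integrable_continuous)
  then show ?thesis using mollifier0_integral_pos[where 'n = 'n] unfolding mollifier_def[abs_def] by simp
qed

text \<open>An average of translates of \<open>f\<close> at scale 1/m. Here \<open>x\<close> occurs
  in \<open>f\<close>, so derivatives of a C1 function pass inside as in \<open>moll_pd\<close>;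
  smoothness comes from the substituted form in \<open>moll_eq_convolve\<close>.\<close>

definition moll :: "real \<Rightarrow> (real^'n::finite \<Rightarrow> real) \<Rightarrow> real^'n \<Rightarrow> real" where
  "moll m f x = integral unit_cube (\<lambda>y :: real^'n. mollifier y * f (x - y /\<^sub>R m))"

lemma moll_integrable:
  assumes "continuous_on UNIV f"
  shows "(\<lambda>y. mollifier y * f (x - y /\<^sub>R m)) integrable_on unit_cube"
  by (intro integrable_continuous continuous_intros bump_continuous[OF mollifier_bump]
      continuous_on_compose2[OF assms]) auto

lemma moll_uminus: "moll m (\<lambda>x. - f x) = (\<lambda>x. - moll m f x)"
  by (simp add: moll_def[abs_def])

text \<open>A weighted average of values within \<open>e\<close> of \<open>c\<close> is within
  \<open>e\<close> of \<open>c\<close>, the weights being nonnegative with integral 1. This gives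
  pointwise convergence, and with \<open>c = 0\<close> the uniform bounds.\<close>

lemma moll_close:
  fixes f :: "real^'n::finite \<Rightarrow> real"
  assumes f: "continuous_on UNIV f" and b: "\<And>y. y \<in> unit_cube \<Longrightarrow> \<bar>f (x - y /\<^sub>R m) - c\<bar> \<le> e"
  shows "\<bar>moll m f x - c\<bar> \<le> e"
proof -
  have k: "((\<lambda>y :: real^'n. mollifier y * c) has_integral c) unit_cube" for c
    using has_integral_mult_left[OF mollifier_integral, of c] by simp
  have "moll m f x - c = integral unit_cube (\<lambda>y :: real^'n. mollifier y * f (x - y /\<^sub>R m)) - integral unit_cube (\<lambda>y :: real^'n. mollifier y * c)"
    using integral_unique[OF k] by (simp add: moll_def)
  also have "\<dots> = integral unit_cube (\<lambda>y :: real^'n. mollifier y * f (x - y /\<^sub>R m) - mollifier y * c)"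
    using k by (intro integral_diff[symmetric] moll_integrable f) auto
  finally have eq: "moll m f x - c = integral unit_cube (\<lambda>y :: real^'n. mollifier y * f (x - y /\<^sub>R m) - mollifier y * c)" .
  have "norm (integral unit_cube (\<lambda>y :: real^'n. mollifier y * f (x - y /\<^sub>R m) - mollifier y * c)) \<le> integral unit_cube (\<lambda>y :: real^'n. mollifier y * e)"
  proof (rule integral_norm_bound_integral)
    show "(\<lambda>y :: real^'n. mollifier y * f (x - y /\<^sub>R m) - mollifier y * c) integrable_on unit_cube"
      using k by (intro integrable_diff moll_integrable f) auto
    fix y :: "real^'n" assume "y \<in> unit_cube"
    then show "norm (mollifier y * f (x - y /\<^sub>R m) - mollifier y * c) \<le> mollifier y * e"
      using mult_left_mono[OF b mollifier_nonneg, of y y] mollifier_nonneg[of y]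
      by (simp flip: right_diff_distrib add: abs_mult)
  qed (use k in auto)
  then show ?thesis unfolding eq using integral_unique[OF mollifier_integral[where 'n = 'n]] by simp
qed

lemma moll_bounded:
  assumes "continuous_on UNIV f" "\<And>x. \<bar>f x\<bar> \<le> C"
  shows "\<bar>moll m f x\<bar> \<le> C"
  using moll_close[of f x m 0 C] assms by simp

lemma norm_unit_cube: "y \<in> unit_cube \<Longrightarrow> norm (y :: real^'n) \<le> CARD('n)"
proof -
  assume "y \<in> unit_cube"
  then have "(\<Sum>i\<in>UNIV. \<bar>y $ i\<bar>) \<le> (\<Sum>i\<in>(UNIV :: 'n set). 1)"
    by (intro sum_mono) (auto simp: mem_box_cart abs_le_iff minus_le_iff)
  then show ?thesis using norm_le_l1_cart[of y] by simp
qed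

lemma moll_tendsto:
  fixes f :: "real^'n::finite \<Rightarrow> real"
  assumes f: "continuous_on UNIV f"
  shows "(\<lambda>m. moll (real (Suc m)) f x) \<longlonglongrightarrow> f x"
proof (rule LIMSEQ_I)
  fix r :: real assume r: "r > 0"
  have "isCont f x" using f by (simp add: continuous_on_eq_continuous_at)
  then obtain d where d: "d > 0" "\<And>y. dist y x < d \<Longrightarrow> \<bar>f y - f x\<bar> < r / 2"
    unfolding continuous_at_eps_delta dist_real_def using r by (metis half_gt_zero)
  obtain N where N: "real CARD('n) / d < real N" using reals_Archimedean2 by blast
  have "norm (moll (real (Suc m)) f x - f x) < r" if "m \<ge> N" for m
  proof -
    have "\<bar>moll (real (Suc m)) f x - f x\<bar> \<le> r / 2"
    proof (rule moll_close[OF f])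
      fix y :: "real^'n" assume y: "y \<in> unit_cube"
      have "norm y / real (Suc m) \<le> CARD('n) / real (Suc m)"
        using norm_unit_cube[OF y] by (intro divide_right_mono) auto
      also have "\<dots> < d" using N that d(1)
        by (smt (verit) divide_less_eq mult.commute of_nat_Suc of_nat_0_le_iff of_nat_mono)
      finally have "dist (x - y /\<^sub>R real (Suc m)) x < d"
        by (simp add: dist_norm divide_inverse mult.commute del: of_nat_Suc)
      then show "\<bar>f (x - y /\<^sub>R real (Suc m)) - f x\<bar> \<le> r / 2" using d(2) by fastforce
    qed
    then show ?thesis using r by simp
  qed
  then show "\<exists>no. \<forall>n\<ge>no. norm (moll (real (Suc n)) f x - f x) < r" by blast
qed

text \<open>The averaged points lie within \<open>CARD('n) / m\<close> of \<open>x\<close>, because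
  points of the unit cube have norm at most \<open>CARD('n)\<close>; so none of them lies in
  \<open>K\<close>.\<close>

lemma moll_zero:
  fixes f :: "real^'n::finite \<Rightarrow> real"
  assumes "m > 0" and "\<And>y. y \<in> K \<Longrightarrow> dist y x > CARD('n) / m" and "\<And>x. x \<notin> K \<Longrightarrow> f x = 0"
  shows "moll m f x = 0"
proof -
  have "f (x - y /\<^sub>R m) = 0" if y: "y \<in> unit_cube" for y :: "real^'n"
  proof -
    have "dist (x - y /\<^sub>R m) x \<le> CARD('n) / m"
      using norm_unit_cube[OF y] assms(1) by (simp add: dist_norm field_simps)
    then show ?thesis using assms(2)[of "x - y /\<^sub>R m"] assms(3) by force
  qed
  then have "moll m f x = integral unit_cube (\<lambda>y :: real^'n. 0)"
    unfolding moll_def by (intro integral_cong) auto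
  then show ?thesis by simp
qed

lemma moll_pd:
  fixes f :: "real^'n::finite \<Rightarrow> real"
  assumes f: "\<And>x. (f has_derivative blinfun_apply (D x)) (at x)" and D: "continuous_on UNIV D"
  shows "pd i (moll m f) x = moll m (pd i f) x"
proof -
  have fc: "continuous_on S f" for S
    using f by (rule has_derivative_imp_continuous_on)
  let ?D = "\<lambda>x y. mollifier y *\<^sub>R D (x - y /\<^sub>R m)"
  have *: "(moll m f has_derivative integral unit_cube (?D x)) (at x)"
    unfolding moll_def[abs_def]
  proof (rule leibniz_rule[where U = UNIV, simplified])
    fix x t :: "real^'n"
    have "((\<lambda>x. f (x - t /\<^sub>R m)) has_derivative blinfun_apply (D (x - t /\<^sub>R m))) (at x)"
      by (rule has_derivative_compose[OF _ f]) (auto intro!: derivative_eq_intros)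
    moreover have "blinfun_apply (?D x t) = (\<lambda>h. mollifier t * blinfun_apply (D (x - t /\<^sub>R m)) h)"
      by (auto simp: blinfun.scaleR_left)
    ultimately show "((\<lambda>x. mollifier t * f (x - t /\<^sub>R m)) has_derivative blinfun_apply (?D x t)) (at x)"
      using has_derivative_mult_right[of "\<lambda>x. f (x - t /\<^sub>R m)" _ "at x" "mollifier t"] by simp
  next
    show "continuous_on (UNIV \<times> unit_cube) (\<lambda>(x, y). ?D x y)"
      unfolding case_prod_beta
      by (intro continuous_intros continuous_on_compose2[OF D]
          continuous_on_compose2[OF bump_continuous[OF mollifier_bump]]) auto
  qed (intro moll_integrable fc)
  have "?D x integrable_on unit_cube"
    by (intro integrable_continuous continuous_intros continuous_on_compose2[OF D] bump_continuous[OF mollifier_bump]) auto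
  then have "blinfun_apply (integral unit_cube (?D x)) (axis i 1)
      = integral unit_cube (\<lambda>y. blinfun_apply (?D x y) (axis i 1))"
    by (rule blinfun_apply_integral)
  then show ?thesis
    unfolding pd_eq[OF *] moll_def pd_eq[OF f, abs_def] by (simp add: blinfun.scaleR_left)
qed

text \<open>This is the substitution z = x - y/m, with Jacobian factor
  \<open>m ^ CARD('n)\<close>.\<close>

lemma moll_eq_convolve:
  fixes f :: "real^'n::finite \<Rightarrow> real"
  assumes f: "continuous_on UNIV f" and m: "m > 0" and K: "\<And>x. x \<notin> cbox c d \<Longrightarrow> f x = 0"
  shows "moll m f = convolve c d f (\<lambda>y. m ^ CARD('n) * mollifier (m *\<^sub>R y))"
proof
  fix x
  let ?F = "\<lambda>y. mollifier y * f (x - y /\<^sub>R m)"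
  \<comment> \<open>The image of the unit cube under y \<mapsto> x - y/m, in the shape produced by
    \<open>has_integral_affinity\<close>.\<close>
  let ?S = "(\<lambda>z. (1 / (- m)) *\<^sub>R z + - ((1 / (- m)) *\<^sub>R (m *\<^sub>R x))) ` (unit_cube :: (real^'n) set)"
  have F: "?F ((- m) *\<^sub>R z + m *\<^sub>R x) = mollifier (m *\<^sub>R (x - z)) * f z" for z
    using m by (simp add: scaleR_right_diff_distrib scaleR_right_distrib)
  have "((\<lambda>z. ?F ((- m) *\<^sub>R z + m *\<^sub>R x)) has_integral (1 / (\<bar>- m\<bar> ^ DIM(real^'n))) *\<^sub>R moll m f x) ?S"
    unfolding moll_def using m by (intro has_integral_affinity integrable_integral moll_integrable f) auto
  then have "((\<lambda>z. mollifier (m *\<^sub>R (x - z)) * f z) has_integral moll m f x / m ^ CARD('n)) ?S"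
    unfolding F using m by simp
  \<comment> \<open>The domain depends on \<open>x\<close>. It is enlarged to the whole space, the
    mollifier vanishing outside the cube, and then cut down to the fixed box outside which
    \<open>f\<close> vanishes.\<close>
  then have "((\<lambda>z. mollifier (m *\<^sub>R (x - z)) * f z) has_integral moll m f x / m ^ CARD('n)) UNIV"
  proof (rule has_integral_on_superset)
    fix z assume z: "z \<notin> ?S"
    have "m *\<^sub>R (x - z) \<notin> unit_cube"
    proof
      assume *: "m *\<^sub>R (x - z) \<in> unit_cube"
      have "z = (1 / (- m)) *\<^sub>R (m *\<^sub>R (x - z)) + - ((1 / (- m)) *\<^sub>R (m *\<^sub>R x))"
        using m by simp
      then show False using z imageI[OF *, of "\<lambda>z. (1 / (- m)) *\<^sub>R z + - ((1 / (- m)) *\<^sub>R (m *\<^sub>R x))"] by metis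
    qed
    then show "mollifier (m *\<^sub>R (x - z)) * f z = 0" by (simp add: mollifier_zero)
  qed simp
  then have "((\<lambda>z. mollifier (m *\<^sub>R (x - z)) * f z) has_integral moll m f x / m ^ CARD('n)) (cbox c d)"
    by (subst has_integral_restrict_UNIV[symmetric], elim has_integral_eq[rotated]) (use K in auto)
  from has_integral_mult_right[OF this, of "m ^ CARD('n)"]
  show "moll m f x = convolve c d f (\<lambda>y. m ^ CARD('n) * mollifier (m *\<^sub>R y)) x"
    unfolding convolve_def using m by (subst integral_unique[where y = "moll m f x"]) (auto simp: mult_ac)
qed

lemma smooth_moll:
  fixes f :: "real^'n::finite \<Rightarrow> real"
  assumes "continuous_on UNIV f" "m > 0" "bounded K" "\<And>x. x \<notin> K \<Longrightarrow> f x = 0"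
  shows "smooth (moll m f)"
proof -
  obtain a where "K \<subseteq> cbox (- a) a" using bounded_subset_cbox_symmetric[OF assms(3)] .
  then have "moll m f = convolve (- a) a f (\<lambda>y. m ^ CARD('n) * mollifier (m *\<^sub>R y))"
    using assms by (intro moll_eq_convolve) auto
  then show ?thesis
    using smooth_convolve[OF continuous_on_subset[OF assms(1) subset_UNIV] mollifier_scaled_bump] by metis
qed

section \<open>The boundary identity for forms of class C1\<close>

lemma C1_onE:
  assumes "C1_on S f"
  obtains D where "\<And>x. x \<in> S \<Longrightarrow> (f has_derivative blinfun_apply (D x)) (at x)" "continuous_on S D"
  using assms unfolding C1_on_def by blast

lemma C1_on_continuous: "C1_on S f \<Longrightarrow> continuous_on S f"
  by (elim C1_onE) (meson continuous_at_imp_continuous_on has_derivative_continuous)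

lemma C1_on_pd_continuous:
  fixes f :: "real^'n::finite \<Rightarrow> real"
  assumes "C1_on S f"
  shows "continuous_on S (pd i f)"
proof -
  obtain D where D: "\<And>x. x \<in> S \<Longrightarrow> (f has_derivative blinfun_apply (D x)) (at x)" "continuous_on S D"
    using C1_onE[OF assms] by metis
  have "continuous_on S (\<lambda>x. blinfun_apply (D x) (axis i 1))"
    by (intro continuous_intros D)
  then show ?thesis
    by (rule continuous_on_eq) (simp add: pd_eq[OF D(1)])
qed

lemma pd_zero_outside:
  fixes f :: "real^'n::finite \<Rightarrow> real"
  assumes "closed K" "\<And>x. x \<notin> K \<Longrightarrow> f x = 0" "x \<notin> K"
  shows "pd i f x = 0"
proof -
  have "(f has_derivative (\<lambda>h. 0)) (at x)"
    by (rule has_derivative_transform_within_open[of "\<lambda>x. 0" _ _ _ "- K"]) (use assms in auto)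
  from pd_eq[OF this] show ?thesis by simp
qed

lemma continuous_compact_support_bounded:
  fixes f :: "real^'n::finite \<Rightarrow> real"
  assumes "continuous_on UNIV f" "compact K" "\<And>x. x \<notin> K \<Longrightarrow> f x = 0"
  obtains C where "\<And>x. \<bar>f x\<bar> \<le> C"
proof -
  have "compact (f ` K)"
    by (rule compact_continuous_image[OF continuous_on_subset[OF assms(1)] assms(2)]) simp
  then obtain C where "\<And>y. y \<in> f ` K \<Longrightarrow> norm y \<le> C"
    using compact_imp_bounded bounded_iff by metis
  then have "\<bar>f x\<bar> \<le> max C 0" for x
    using assms(3)[of x] by (cases "x \<in> K") (auto simp: le_max_iff_disj)
  then show ?thesis using that by blast
qed

lemma continuous_imp_borel_measurable:
  assumes "sets M = sets borel" "continuous_on UNIV f"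
  shows "f \<in> borel_measurable M"
  using borel_measurable_continuous_onI[OF assms(2)] by (simp cong: measurable_cong_sets add: assms(1))

text \<open>Dominated convergence: uniform bounds \<open>C l\<close> on the coefficients and
  integrability of the coordinates of \<open>\<tau>\<close> provide the dominating function.\<close>

lemma integral_pair_tendsto:
  fixes c :: "nat \<Rightarrow> real^'n::finite \<Rightarrow> 'n list \<Rightarrow> real"
  assumes M: "sets M = sets borel" and \<tau>: "\<And>l. integrable M (\<lambda>x. \<tau> x l)"
    and c: "\<And>m l. continuous_on UNIV (\<lambda>x. c m x l)"
    and lim: "\<And>x l. (\<lambda>m. c m x l) \<longlonglongrightarrow> c' x l"
    and C: "\<And>m x l. \<bar>c m x l\<bar> \<le> C l"
  shows "(\<lambda>m. \<integral>x. pair h (c m x) (\<tau> x) \<partial>M) \<longlonglongrightarrow> (\<integral>x. pair h (c' x) (\<tau> x) \<partial>M)"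
proof (rule integral_dominated_convergence)
  have cm: "(\<lambda>x. c m x l) \<in> borel_measurable M" for m l
    by (rule continuous_imp_borel_measurable[OF M c])
  have c'm: "(\<lambda>x. c' x l) \<in> borel_measurable M" for l
    by (rule borel_measurable_LIMSEQ_real[OF lim cm])
  show "(\<lambda>x. pair h (c' x) (\<tau> x)) \<in> borel_measurable M"
    unfolding pair_def using c'm \<tau>
    by (intro borel_measurable_divide borel_measurable_sum borel_measurable_times) auto
  show "(\<lambda>x. pair h (c m x) (\<tau> x)) \<in> borel_measurable M" for m
    unfolding pair_def using cm \<tau>
    by (intro borel_measurable_divide borel_measurable_sum borel_measurable_times) auto
  show "integrable M (\<lambda>x. (\<Sum>l | length l = h. C l * \<bar>\<tau> x l\<bar>) / fact h)"
    using \<tau> by (intro integrable_divide Bochner_Integration.integrable_sum integrable_mult_right integrable_abs) auto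
  show "AE x in M. (\<lambda>m. pair h (c m x) (\<tau> x)) \<longlonglongrightarrow> pair h (c' x) (\<tau> x)"
    unfolding pair_def by (intro AE_I2 tendsto_intros lim) auto
  show "AE x in M. norm (pair h (c m x) (\<tau> x)) \<le> (\<Sum>l | length l = h. C l * \<bar>\<tau> x l\<bar>) / fact h" for m
  proof (rule AE_I2)
    fix x
    have "\<bar>\<Sum>l | length l = h. c m x l * \<tau> x l\<bar> \<le> (\<Sum>l | length l = h. C l * \<bar>\<tau> x l\<bar>)"
      by (intro order_trans[OF sum_abs] sum_mono) (simp add: abs_mult mult_right_mono C)
    then show "norm (pair h (c m x) (\<tau> x)) \<le> (\<Sum>l | length l = h. C l * \<bar>\<tau> x l\<bar>) / fact h"
      by (simp add: pair_def abs_divide divide_right_mono)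
  qed
qed

text \<open>The coefficients are mollified one by one. Derivatives commute with mollification, so
  both the form and its exterior derivative converge pointwise with uniform bounds, and the identity
  for test forms passes to the limit.\<close>

lemma boundary_C1_form:
  fixes \<omega> :: "real^'n::finite \<Rightarrow> 'n list \<Rightarrow> real"
  assumes "open \<Omega>" and T: "normal_current_repr \<Omega> k \<mu> \<tau> \<mu>' \<tau>'"
    and mv: "\<And>x. is_mv (k - 1) (\<omega> x)" and C1: "\<And>l. C1_on UNIV (\<lambda>x. \<omega> x l)"
    and K: "compact K" "K \<subseteq> \<Omega>" "\<And>x l. x \<notin> K \<Longrightarrow> \<omega> x l = 0"
  shows "(\<integral>x. pair k (dform k \<omega> x) (\<tau> x) \<partial>\<mu>) = (\<integral>x. pair (k - 1) (\<omega> x) (\<tau>' x) \<partial>\<mu>')"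
proof -
  define w where "w m x l = moll (real (Suc m)) (\<lambda>y. \<omega> y l) x" for m x l
  have M: "sets \<mu> = sets borel" "sets \<mu>' = sets borel" "\<And>l. integrable \<mu> (\<lambda>x. \<tau> x l)"
    "\<And>l. integrable \<mu>' (\<lambda>x. \<tau>' x l)"
    and bd: "\<And>\<omega>. test_form \<Omega> (k - 1) \<omega> \<Longrightarrow>
      (\<integral>x. pair k (dform k \<omega> x) (\<tau> x) \<partial>\<mu>) = (\<integral>x. pair (k - 1) (\<omega> x) (\<tau>' x) \<partial>\<mu>')"
    using T unfolding normal_current_repr_def finite_measure_on_def by blast+
  have cont: "continuous_on UNIV (\<lambda>x. \<omega> x l)" for l using C1 by (rule C1_on_continuous)
  have cpd: "continuous_on UNIV (pd i (\<lambda>x. \<omega> x l))" for i l using C1 by (rule C1_on_pd_continuous)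
  have smooth: "smooth (\<lambda>x. w m x l)" for m l
    unfolding w_def using K compact_imp_bounded[OF K(1)] by (intro smooth_moll[OF cont]) auto
  have pdw: "pd i (\<lambda>x. w m x l) = (\<lambda>x. moll (real (Suc m)) (pd i (\<lambda>y. \<omega> y l)) x)" for i m l
  proof
    fix x
    obtain D where "\<And>x. ((\<lambda>y. \<omega> y l) has_derivative blinfun_apply (D x)) (at x)" "continuous_on UNIV D"
      using C1_onE[OF C1[of l]] by (metis UNIV_I)
    then show "pd i (\<lambda>x. w m x l) x = moll (real (Suc m)) (pd i (\<lambda>y. \<omega> y l)) x"
      unfolding w_def by (rule moll_pd)
  qed
  \<comment> \<open>Alternation consists of linear relations between coefficients, which
    mollification preserves.\<close>
  have mvw: "is_mv (k - 1) (w m x)" for m x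
    unfolding is_mv_def
  proof (intro conjI allI impI)
    fix l :: "'n list" assume "length l \<noteq> k - 1"
    then have "(\<lambda>y. \<omega> y l) = (\<lambda>y. 0)" using mv by (auto simp: is_mv_def)
    then show "w m x l = 0" by (simp add: w_def moll_def)
  next
    fix l :: "'n list" and i j assume "i < j \<and> j < length l"
    then have "(\<lambda>y. \<omega> y (l[i := l ! j, j := l ! i])) = (\<lambda>y. - \<omega> y l)"
      using is_mv_swap[OF mv] by auto
    then show "w m x (l[i := l ! j, j := l ! i]) = - w m x l"
      by (simp add: w_def moll_uminus)
  qed
  obtain e where e: "e > 0" "(\<Union>x\<in>K. cball x e) \<subseteq> \<Omega>"
    using compact_subset_open_imp_cball_epsilon_subset[OF K(1) assms(1) K(2)] .
  \<comment> \<open>From index \<open>N\<close> on, mollification moves points by less than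
    \<open>e\<close>. The forms \<open>w (m + N)\<close> therefore vanish outside the closed
    \<open>e\<close>-neighbourhood \<open>?K\<close> of \<open>K\<close>, which lies in
    \<open>\<Omega>\<close>.\<close>
  obtain N :: nat where N: "real CARD('n) / e < real N" using reals_Archimedean2 by blast
  let ?K = "{x + y |x y. x \<in> K \<and> y \<in> cball 0 e}"
  have test: "test_form \<Omega> (k - 1) (w (m + N))" for m
    unfolding test_form_def
  proof (intro conjI allI mvw smooth exI[of _ ?K] impI)
    show "compact ?K" by (intro compact_sums K(1) compact_cball)
    show "?K \<subseteq> \<Omega>"
    proof
      fix z assume "z \<in> ?K"
      then obtain x y where "z = x + y" "x \<in> K" "norm y \<le> e" by auto
      then have "z \<in> cball x e" by (simp add: dist_norm)
      then show "z \<in> \<Omega>" using e(2) \<open>x \<in> K\<close> by blast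
    qed
    fix z assume z: "z \<notin> ?K"
    have "real CARD('n) / real (Suc (m + N)) < e"
    proof -
      have "real CARD('n) < e * real N" using N e(1) by (simp add: field_simps)
      also have "\<dots> \<le> e * real (Suc (m + N))" using e(1) by (intro mult_left_mono) auto
      finally show ?thesis by (simp add: divide_less_eq)
    qed
    moreover have "dist y z > e" if "y \<in> K" for y
    proof (rule ccontr)
      assume "\<not> dist y z > e"
      then have "z = y + (z - y)" "z - y \<in> cball 0 e" by (auto simp: dist_norm norm_minus_commute)
      then show False using z that by blast
    qed
    ultimately have "w (m + N) z l = 0" for l
      unfolding w_def by (intro moll_zero[of _ K]) (use K(3) in force)+
    then show "w (m + N) z = (\<lambda>_. 0)" by auto
  qed
  have "\<exists>C. \<forall>x. \<bar>\<omega> x l\<bar> \<le> C" for l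
    by (rule continuous_compact_support_bounded[OF cont[of l] K(1)]) (use K(3) in auto)
  then obtain C0 where C0: "\<And>x l. \<bar>\<omega> x l\<bar> \<le> C0 l" by metis
  have "\<exists>C. \<forall>x. \<bar>pd i (\<lambda>y. \<omega> y l) x\<bar> \<le> C" for i l
    by (rule continuous_compact_support_bounded[OF cpd[of i l] K(1)])
      (use pd_zero_outside[OF compact_imp_closed[OF K(1)], of "\<lambda>y. \<omega> y l" _ i] K(3) in auto)
  then obtain C1' where C1': "\<And>i l x. \<bar>pd i (\<lambda>y. \<omega> y l) x\<bar> \<le> C1' i l" by metis
  have lim1: "(\<lambda>m. \<integral>x. pair (k - 1) (w (m + N) x) (\<tau>' x) \<partial>\<mu>') \<longlonglongrightarrow> (\<integral>x. pair (k - 1) (\<omega> x) (\<tau>' x) \<partial>\<mu>')"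
  proof (rule integral_pair_tendsto[OF M(2,4)])
    show "continuous_on UNIV (\<lambda>x. w (m + N) x l)" for m l by (rule smooth_continuous[OF smooth])
    show "(\<lambda>m. w (m + N) x l) \<longlonglongrightarrow> \<omega> x l" for x l
      using LIMSEQ_ignore_initial_segment[OF moll_tendsto[OF cont]] unfolding w_def .
    show "\<bar>w (m + N) x l\<bar> \<le> C0 l" for m x l
      unfolding w_def by (rule moll_bounded[OF cont C0])
  qed
  have lim2: "(\<lambda>m. \<integral>x. pair k (dform k (w (m + N)) x) (\<tau> x) \<partial>\<mu>) \<longlonglongrightarrow> (\<integral>x. pair k (dform k \<omega> x) (\<tau> x) \<partial>\<mu>)"
  proof (rule integral_pair_tendsto[OF M(1,3)])
    show "continuous_on UNIV (\<lambda>x. dform k (w (m + N)) x l)" for m l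
      unfolding dform_def
      by (cases "length l = k") (auto intro!: continuous_intros smooth_continuous[OF smooth_pd[OF smooth]])
    show "(\<lambda>m. dform k (w (m + N)) x l) \<longlonglongrightarrow> dform k \<omega> x l" for x l
      unfolding dform_def pdw using LIMSEQ_ignore_initial_segment[OF moll_tendsto[OF cpd], of N]
      by (cases "length l = k") (auto intro!: tendsto_intros)
    show "\<bar>dform k (w (m + N)) x l\<bar> \<le> (\<Sum>j<k. C1' (l ! j) (take j l @ drop (Suc j) l))" for m x l
    proof -
      have "\<bar>\<Sum>j<k. (-1) ^ j * moll (real (Suc (m + N))) (pd (l ! j) (\<lambda>y. \<omega> y (take j l @ drop (Suc j) l))) x\<bar>
        \<le> (\<Sum>j<k. C1' (l ! j) (take j l @ drop (Suc j) l))"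
        using moll_bounded[OF cpd C1']
        by (intro order_trans[OF sum_abs] sum_mono) (simp add: abs_mult)
      moreover have "0 \<le> (\<Sum>j<k. C1' (l ! j) (take j l @ drop (Suc j) l))"
        by (intro sum_nonneg order_trans[OF abs_ge_zero C1'])
      ultimately show ?thesis unfolding dform_def pdw by auto
    qed
  qed
  show ?thesis
    using LIMSEQ_unique[OF lim2] lim1 by (simp add: bd[OF test])
qed

section \<open>Densities that vanish against all C1 test functions\<close>

lemma bump_C1:
  fixes g :: "real^'n::finite \<Rightarrow> real"
  assumes "bump g"
  shows "C1_on S g"
proof -
  from assms obtain G where G: "\<And>i. bump (G i)" "\<And>x. (g has_derivative (\<lambda>h. \<Sum>i\<in>UNIV. h $ i * G i x)) (at x)"
    using bump_deriv[of g] by blast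
  let ?D = "\<lambda>x. \<Sum>i\<in>UNIV. G i x *\<^sub>R (blinfun_inner_right (axis i 1) :: (real^'n) \<Rightarrow>\<^sub>L real)"
  have "blinfun_apply (?D x) = (\<lambda>h. \<Sum>i\<in>UNIV. h $ i * G i x)" for x
    by (rule ext) (simp add: blinfun.sum_left blinfun.scaleR_left inner_axis' mult.commute)
  moreover have "continuous_on S ?D"
    by (intro continuous_intros bump_continuous[OF G(1)])
  ultimately show ?thesis unfolding C1_on_def using G(2) by (intro exI[of _ ?D]) auto
qed

lemma bump_power: "bump g \<Longrightarrow> bump (\<lambda>x. g x ^ n)"
  by (induction n) (auto intro: bump_const bump_mult)

text \<open>The functions \<open>1 - (1 - p) ^ m\<close>, with \<open>p\<close> positive exactly on a box, increase to the
  indicator of that box.\<close>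

lemma integral_box_zero:
  fixes g :: "real^'n::finite \<Rightarrow> real"
  assumes M: "sets M = sets borel" and sub: "box c d \<subseteq> K" and "compact K" "K \<subseteq> \<Omega>"
    and int: "integrable M (\<lambda>x. indicator K x * g x)"
    and test: "\<And>\<eta>. C1_on UNIV \<eta> \<Longrightarrow> (\<And>x. x \<notin> K \<Longrightarrow> \<eta> x = 0) \<Longrightarrow> (\<integral>x. \<eta> x * g x \<partial>M) = 0"
  shows "(\<integral>x. indicator (box c d) x * g x \<partial>M) = 0"
proof -
  define p where "p x = (\<Prod>i\<in>UNIV. flat 1 (- c $ i + 1 * x $ i) * flat 1 (d $ i + (-1) * x $ i))" for x :: "real^'n"
  have p: "bump p" unfolding p_def[abs_def] by (intro bump_prod bump_mult bump_flat) simp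
  have f1: "flat 1 t \<le> 1" for t by (simp add: flat_def)
  have p0: "0 \<le> p x" "p x \<le> 1" for x
    unfolding p_def
    by (auto intro!: prod_nonneg prod_le_1 mult_le_one flat_1 f1 mult_nonneg_nonneg)
  have p_in: "x \<in> box c d \<longleftrightarrow> p x > 0" for x
  proof -
    have "p x = 0 \<longleftrightarrow> x \<notin> box c d"
      unfolding p_def by (auto simp: mem_box_cart flat_1 not_less)
    then show ?thesis using p0(1)[of x] by auto
  qed
  define \<eta> where "\<eta> m x = 1 + (-1) * (1 + (-1) * p x) ^ m" for m :: nat and x
  have "bump (\<eta> m)" for m
    unfolding \<eta>_def[abs_def] by (intro bump_add bump_mult bump_const bump_power p)
  then have C1: "C1_on UNIV (\<eta> m)" for m by (rule bump_C1)
  have eta0: "\<eta> m x = 0" if "x \<notin> box c d" for m x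
    using that p_in[of x] p0(1)[of x] by (simp add: \<eta>_def)
  have eta1: "0 \<le> \<eta> m x" "\<eta> m x \<le> 1" for m x
    using p0[of x] power_le_one[of "1 - p x" m] by (auto simp: \<eta>_def)
  \<comment> \<open>Only the restriction of \<open>g\<close> to \<open>K\<close> is known to be
    integrable; inserting the indicator changes nothing, as \<open>\<eta> m\<close> vanishes outside
    \<open>K\<close>.\<close>
  have etac: "\<eta> m x * g x = \<eta> m x * (indicator K x * g x)" for m x
    using eta0[of x m] sub by (cases "x \<in> K") auto
  have gm: "(\<lambda>x. indicator K x * g x) \<in> borel_measurable M" using int by auto
  have "(\<lambda>m. \<integral>x. \<eta> m x * (indicator K x * g x) \<partial>M) \<longlonglongrightarrow> (\<integral>x. indicator (box c d) x * (indicator K x * g x) \<partial>M)"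
  proof (rule integral_dominated_convergence)
    show "(\<lambda>x. indicator (box c d) x * (indicator K x * g x)) \<in> borel_measurable M"
      by (intro borel_measurable_times gm borel_measurable_indicator) (simp add: M)
    show "(\<lambda>x. \<eta> m x * (indicator K x * g x)) \<in> borel_measurable M" for m
      by (intro borel_measurable_times gm continuous_imp_borel_measurable[OF M] C1_on_continuous C1)
    show "integrable M (\<lambda>x. norm (indicator K x * g x))" using int by (rule integrable_norm)
    show "AE x in M. (\<lambda>m. \<eta> m x * (indicator K x * g x)) \<longlonglongrightarrow> indicator (box c d) x * (indicator K x * g x)"
    proof (intro AE_I2 tendsto_mult tendsto_const)
      fix x
      show "(\<lambda>m. \<eta> m x) \<longlonglongrightarrow> indicator (box c d) x"
      proof (cases "x \<in> box c d")
        case True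
        then have "(\<lambda>m. (1 - p x) ^ m) \<longlonglongrightarrow> 0"
          using p0[of x] p_in[of x] by (intro LIMSEQ_power_zero) auto
        from tendsto_diff[OF tendsto_const[of 1] this] show ?thesis
          using True by (simp add: \<eta>_def)
      qed (simp add: eta0)
    qed
    show "AE x in M. norm (\<eta> m x * (indicator K x * g x)) \<le> norm (indicator K x * g x)" for m
      using eta1[of m] by (intro AE_I2) (simp add: abs_mult mult_left_le_one_le)
  qed
  moreover have "(\<integral>x. \<eta> m x * (indicator K x * g x) \<partial>M) = 0" for m
    unfolding etac[symmetric] using sub by (intro test C1 eta0) auto
  ultimately have "(\<integral>x. indicator (box c d) x * (indicator K x * g x) \<partial>M) = 0"
    by (simp add: LIMSEQ_const_iff)
  moreover have "indicator (box c d) x * (indicator K x * g x) = indicator (box c d) x * g x" for x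
    using sub by (auto split: split_indicator)
  ultimately show ?thesis by simp
qed

text \<open>The signed measure with density \<open>g\<close> on the box gives zero to every open
  box. Open boxes are closed under intersection and generate the Borel sets, so it vanishes on all
  of these and its density is zero almost everywhere.\<close>

lemma AE_zero_on_box:
  fixes g :: "real^'n::finite \<Rightarrow> real"
  assumes M: "sets M = sets borel" and fin: "finite_measure M"
    and int: "integrable M (\<lambda>x. indicator (cbox a b) x * g x)"
    and test: "\<And>\<eta>. C1_on UNIV \<eta> \<Longrightarrow> (\<And>x. x \<notin> cbox a b \<Longrightarrow> \<eta> x = 0) \<Longrightarrow> (\<integral>x. \<eta> x * g x \<partial>M) = 0"
  shows "AE x in M. x \<in> box a b \<longrightarrow> g x = 0"
proof -
  interpret finite_measure M by fact
  let ?f = "\<lambda>x. indicator (box a b) x * g x"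
  have eq: "?f x = indicator (box a b) x * (indicator (cbox a b) x * g x)" for x
    using box_subset_cbox[of a b] by (auto split: split_indicator)
  have sp: "space M = UNIV" using sets_eq_imp_space_eq[OF M] by simp
  have int_f: "integrable M ?f"
    unfolding eq using integrable_mult_indicator[OF _ int, of "box a b"] by (simp add: M)
  have z: "(\<integral>x. indicator (box c d) x * g x \<partial>M) = 0" if "box c d \<subseteq> cbox a b" for c d
    by (rule integral_box_zero[OF M that compact_cbox subset_refl int test])
  have 0: "(\<integral>x. ?f x \<partial>M) = 0" by (rule z[OF box_subset_cbox])
  let ?E = "range (\<lambda>(a, b). box a b :: (real^'n) set)"
  have "set_lebesgue_integral M A ?f = 0" if A: "A \<in> sigma_sets UNIV ?E" for A
  proof -
    have Int: "Int_stable ?E"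
      by (auto simp: Int_stable_def box_Int_box)
    have sb: "B \<in> sets M" if "B \<in> sigma_sets UNIV ?E" for B
      using that by (simp add: M borel_eq_box)
    have si: "set_integrable M B ?f" if "B \<in> sets M" for B
      unfolding set_integrable_def using integrable_mult_indicator[OF that int_f] .
    from Int subset_UNIV[of "?E", unfolded Pow_UNIV[symmetric]] A show ?thesis
    proof (induction rule: sigma_sets_induct_disjoint)
      case (basic B)
      then obtain c d where B: "B = box c d" by auto
      obtain c' d' where cd: "box c d \<inter> box a b = box c' d'" using box_Int_box by blast
      have "set_lebesgue_integral M B ?f = (\<integral>x. indicator (box c' d') x * g x \<partial>M)"
        unfolding set_lebesgue_integral_def B cd[symmetric]
        by (simp add: indicator_inter_arith mult.assoc)
      also have "\<dots> = 0"
        using cd box_subset_cbox[of a b] by (intro z) blast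
      finally show ?case .
    next
      case empty
      show ?case by (simp add: set_lebesgue_integral_def)
    next
      case (compl B)
      have "set_lebesgue_integral M (UNIV - B) ?f = (\<integral>x. ?f x - indicator B x *\<^sub>R ?f x \<partial>M)"
        unfolding set_lebesgue_integral_def
        by (intro Bochner_Integration.integral_cong refl) (auto split: split_indicator)
      also have "\<dots> = (\<integral>x. ?f x \<partial>M) - set_lebesgue_integral M B ?f"
        unfolding set_lebesgue_integral_def
        by (rule Bochner_Integration.integral_diff[OF int_f si[OF sb[OF compl(1)], unfolded set_integrable_def]])
      finally show ?case using 0 compl by simp
    next
      case (union F)
      have Fm: "F i \<in> sets M" for i using union(2) sb by blast
      have "set_lebesgue_integral M (\<Union>i. F i) ?f = (\<Sum>i. set_lebesgue_integral M (F i) ?f)"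
        by (rule lebesgue_integral_countable_add[OF Fm _ si])
           (use union(1) Fm in \<open>auto simp: disjoint_family_on_def\<close>)
      then show ?case using union by simp
    qed
  qed
  then have "AE x in M. ?f x = 0"
    by (intro density_zero[OF int_f]) (simp add: M borel_eq_box)
  then show ?thesis by eventually_elim auto
qed

text \<open>By the Lindelof property countably many open boxes with closure in
  \<open>\<Omega>\<close> cover \<open>\<Omega>\<close>, so the exceptional null sets of the boxes
  can be united.\<close>

lemma AE_zero_of_test:
  fixes g :: "real^'n::finite \<Rightarrow> real"
  assumes M: "sets M = sets borel" and fin: "finite_measure M" and "open \<Omega>"
    and int: "\<And>K. compact K \<Longrightarrow> K \<subseteq> \<Omega> \<Longrightarrow> integrable M (\<lambda>x. indicator K x * g x)"
    and test: "\<And>\<eta> K. C1_on UNIV \<eta> \<Longrightarrow> compact K \<Longrightarrow> K \<subseteq> \<Omega> \<Longrightarrow> (\<And>x. x \<notin> K \<Longrightarrow> \<eta> x = 0)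
      \<Longrightarrow> (\<integral>x. \<eta> x * g x \<partial>M) = 0"
  shows "AE x in M. x \<in> \<Omega> \<longrightarrow> g x = 0"
proof -
  let ?F = "{box a b | a b. cbox a b \<subseteq> \<Omega>}"
  obtain F where F: "F \<subseteq> ?F" "countable F" "\<Union>F = \<Union>?F"
    using Lindelof[of ?F] by blast
  have "AE x in M. x \<in> B \<longrightarrow> g x = 0" if BF: "B \<in> F" for B
  proof -
    obtain a b where B: "B = box a b" "cbox a b \<subseteq> \<Omega>"
      using subsetD[OF F(1) BF] by blast
    show ?thesis unfolding B(1)
      by (rule AE_zero_on_box[OF M fin int[OF compact_cbox B(2)] test[OF _ compact_cbox B(2)]])
  qed
  then have ae: "AE x in M. \<forall>B\<in>F. x \<in> B \<longrightarrow> g x = 0"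
    using F(2) by (intro AE_ball_countable')
  have sub: "\<Omega> \<subseteq> \<Union>F"
  proof
    fix x assume "x \<in> \<Omega>"
    then obtain a b where ab: "cbox a b \<subseteq> \<Omega>" "x \<in> box a b"
      using open_contains_cbox[OF assms(3)] by metis
    then show "x \<in> \<Union>F" unfolding F(3) by (intro UnionI[of "box a b"]) auto
  qed
  show ?thesis using ae by eventually_elim (use sub in blast)
qed

section \<open>Involutivity\<close>

definition conormal :: "real^'n^'n \<Rightarrow> 'n::finite \<Rightarrow> real^'n" where
  "conormal Q r = axis r 1 - Q *v axis r 1"

definition is_proj :: "real^'n^'n \<Rightarrow> (real^'n::finite) set \<Rightarrow> bool" where
  "is_proj Q W \<longleftrightarrow> subspace W \<and> (\<forall>y. Q *v y \<in> W \<and> (\<forall>z\<in>W. orthogonal (y - Q *v y) z))"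

lemma conormal_inner: "is_proj Q W \<Longrightarrow> z \<in> W \<Longrightarrow> conormal Q r \<bullet> z = 0"
  by (simp add: is_proj_def conormal_def orthogonal_def)

lemma is_proj_fixed:
  assumes "is_proj Q W" "z \<in> W"
  shows "Q *v z = z"
proof -
  have "z - Q *v z \<in> W" using assms by (intro subspace_diff) (auto simp: is_proj_def)
  then have "orthogonal (z - Q *v z) (z - Q *v z)" using assms unfolding is_proj_def by blast
  then show ?thesis by (simp add: orthogonal_def)
qed

lemma conormal_expand: "a - Q *v a = (\<Sum>r\<in>UNIV. a $ r *\<^sub>R conormal Q r)"
proof -
  have a: "a = (\<Sum>r\<in>UNIV. a $ r *\<^sub>R axis r 1)"
    using basis_expansion[of a] by (simp add: scalar_mult_eq_scaleR)
  have "Q *v a = (\<Sum>r\<in>UNIV. a $ r *\<^sub>R (Q *v axis r 1))"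
    by (subst a) (simp add: matrix_vector_mult_scaleR linear_sum[OF matrix_vector_mul_linear])
  then show ?thesis
    by (simp add: conormal_def scaleR_right_diff_distrib sum_subtractf flip: a)
qed

text \<open>\<open>Q\<close> kills a vector \<open>a\<close> orthogonal to \<open>W\<close>: the
  squared norm of \<open>Q *v a\<close> equals the inner product of \<open>a\<close> with
  \<open>Q *v a\<close>, which is zero because \<open>Q *v a\<close> lies in
  \<open>W\<close>.\<close>

lemma conormal_span:
  assumes "is_proj Q W" "\<forall>w\<in>W. a \<bullet> w = 0"
  shows "a = (\<Sum>r\<in>UNIV. a $ r *\<^sub>R conormal Q r)"
proof -
  have "Q *v a \<in> W" "(a - Q *v a) \<bullet> (Q *v a) = 0"
    using assms(1) by (auto simp: is_proj_def orthogonal_def)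
  then have "Q *v a = 0" using assms(2) by (simp add: inner_diff_left)
  then show ?thesis using conormal_expand[of a Q] by simp
qed

lemma mem_iff_conormal:
  assumes "is_proj Q W"
  shows "z \<in> W \<longleftrightarrow> (\<forall>r. conormal Q r \<bullet> z = 0)"
proof
  assume *: "\<forall>r. conormal Q r \<bullet> z = 0"
  have Qz: "Q *v z \<in> W" using assms by (simp add: is_proj_def)
  have "(z - Q *v z) \<bullet> z = 0"
    unfolding conormal_expand using * by (simp add: inner_sum_left)
  moreover have "(z - Q *v z) \<bullet> (Q *v z) = 0"
    using assms Qz by (simp add: is_proj_def orthogonal_def)
  ultimately have "(z - Q *v z) \<bullet> (z - Q *v z) = 0" by (simp add: inner_diff_right)
  then have "z = Q *v z" by simp
  then show "z \<in> W" using Qz by simp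
qed (simp add: conormal_inner[OF assms])

text \<open>The inclusion of subspaces becomes countably many scalar equations, each of which can be
  tested by integration.\<close>

lemma mvspan_subset_iff_conormal:
  assumes "is_proj Q W" "is_mv k v"
  shows "mvspan k v \<subseteq> W \<longleftrightarrow> (\<forall>r q. (\<Sum>a\<in>UNIV. conormal Q r $ a * v (a # q)) = 0)"
proof -
  have W: "subspace W" using assms(1) by (simp add: is_proj_def)
  have "W\<^sup>\<bottom> \<subseteq> contr v \<longleftrightarrow> (\<forall>r. conormal Q r \<in> contr v)"
  proof
    assume "W\<^sup>\<bottom> \<subseteq> contr v"
    then show "\<forall>r. conormal Q r \<in> contr v"
      using conormal_inner[OF assms(1)] by (auto simp: orthogonal_comp_mem_iff)
  next
    assume *: "\<forall>r. conormal Q r \<in> contr v"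
    show "W\<^sup>\<bottom> \<subseteq> contr v"
    proof
      fix a assume "a \<in> W\<^sup>\<bottom>"
      then have "a = (\<Sum>r\<in>UNIV. a $ r *\<^sub>R conormal Q r)"
        by (intro conormal_span[OF assms(1)]) (simp add: orthogonal_comp_mem_iff)
      moreover have "(\<Sum>r\<in>UNIV. a $ r *\<^sub>R conormal Q r) \<in> contr v"
        using * by (intro subspace_sum subspace_mul subspace_contr) auto
      ultimately show "a \<in> contr v" by simp
    qed
  qed
  then show ?thesis unfolding mvspan_subset_iff[OF assms(2) W] by (simp add: contr_def)
qed

section \<open>Calculus of C1 functions\<close>

lemma C1_onI:
  "(\<And>x. x \<in> S \<Longrightarrow> (f has_derivative blinfun_apply (D x)) (at x)) \<Longrightarrow> continuous_on S D \<Longrightarrow> C1_on S f"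
  unfolding C1_on_def by (rule exI[of _ D]) auto

lemma C1_on_const: "C1_on S (\<lambda>x. c)"
  unfolding C1_on_def by (rule exI[of _ "\<lambda>x. 0"]) (simp add: zero_blinfun.rep_eq)

lemma C1_on_linear:
  assumes "C1_on S f" "bounded_linear L"
  shows "C1_on S (\<lambda>x. L (f x))"
proof -
  obtain D where D: "\<And>x. x \<in> S \<Longrightarrow> (f has_derivative blinfun_apply (D x)) (at x)" "continuous_on S D"
    using C1_onE[OF assms(1)] by metis
  have "((\<lambda>x. L (f x)) has_derivative blinfun_apply (Blinfun L o\<^sub>L D x)) (at x)" if "x \<in> S" for x
  proof -
    have "blinfun_apply (Blinfun L o\<^sub>L D x) = (\<lambda>h. L (blinfun_apply (D x) h))"
      by (auto simp: bounded_linear_Blinfun_apply[OF assms(2)])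
    then show ?thesis using bounded_linear.has_derivative[OF assms(2) D(1)[OF that]] by simp
  qed
  moreover have "continuous_on S (\<lambda>x. Blinfun L o\<^sub>L D x)"
    by (intro continuous_intros D)
  ultimately show ?thesis by (rule C1_onI)
qed

lemma C1_on_add:
  assumes "C1_on S f" "C1_on S g"
  shows "C1_on S (\<lambda>x. f x + g x)"
proof -
  obtain D where D: "\<And>x. x \<in> S \<Longrightarrow> (f has_derivative blinfun_apply (D x)) (at x)" "continuous_on S D"
    using C1_onE[OF assms(1)] by metis
  obtain E where E: "\<And>x. x \<in> S \<Longrightarrow> (g has_derivative blinfun_apply (E x)) (at x)" "continuous_on S E"
    using C1_onE[OF assms(2)] by metis
  have "((\<lambda>x. f x + g x) has_derivative blinfun_apply (D x + E x)) (at x)" if "x \<in> S" for x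
    using has_derivative_add[OF D(1)[OF that] E(1)[OF that]] by (simp add: plus_blinfun.rep_eq)
  moreover have "continuous_on S (\<lambda>x. D x + E x)" by (intro continuous_intros D E)
  ultimately show ?thesis by (rule C1_onI)
qed

lemma C1_on_mult_real:
  fixes f g :: "'a::real_normed_vector \<Rightarrow> real"
  assumes "C1_on S f" "C1_on S g"
  shows "C1_on S (\<lambda>x. f x * g x)"
proof -
  obtain D where D: "\<And>x. x \<in> S \<Longrightarrow> (f has_derivative blinfun_apply (D x)) (at x)" "continuous_on S D"
    using C1_onE[OF assms(1)] by metis
  obtain E where E: "\<And>x. x \<in> S \<Longrightarrow> (g has_derivative blinfun_apply (E x)) (at x)" "continuous_on S E"
    using C1_onE[OF assms(2)] by metis
  have "((\<lambda>x. f x * g x) has_derivative blinfun_apply (f x *\<^sub>R E x + g x *\<^sub>R D x)) (at x)" if "x \<in> S" for x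
    using has_derivative_mult[OF D(1)[OF that] E(1)[OF that]]
    by (simp add: plus_blinfun.rep_eq scaleR_blinfun.rep_eq mult.commute)
  moreover have "continuous_on S (\<lambda>x. f x *\<^sub>R E x + g x *\<^sub>R D x)"
    by (intro continuous_intros D E C1_on_continuous assms)
  ultimately show ?thesis by (rule C1_onI)
qed

lemma C1_on_sum:
  "finite I \<Longrightarrow> (\<And>i. i \<in> I \<Longrightarrow> C1_on S (f i)) \<Longrightarrow> C1_on S (\<lambda>x. \<Sum>i\<in>I. f i x)"
  by (induction rule: finite_induct) (auto intro: C1_on_const C1_on_add)

lemma C1_on_subset: "C1_on T f \<Longrightarrow> S \<subseteq> T \<Longrightarrow> C1_on S f"
  by (elim C1_onE, rule C1_onI) (auto intro: continuous_on_subset)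

lemma C1_on_differentiable: "C1_on S f \<Longrightarrow> x \<in> S \<Longrightarrow> (f has_derivative frechet_derivative f (at x)) (at x)"
  by (elim C1_onE) (auto simp: frechet_derivative_works[symmetric] intro: differentiableI)

lemma C1_on_frechet_continuous:
  assumes "C1_on S f" "continuous_on S u"
  shows "continuous_on S (\<lambda>x. frechet_derivative f (at x) (u x))"
proof -
  obtain D where D: "\<And>x. x \<in> S \<Longrightarrow> (f has_derivative blinfun_apply (D x)) (at x)" "continuous_on S D"
    using C1_onE[OF assms(1)] by metis
  have "continuous_on S (\<lambda>x. blinfun_apply (D x) (u x))" by (intro continuous_intros D assms)
  then show ?thesis
    by (rule continuous_on_eq) (simp add: frechet_derivative_at[OF D(1), symmetric])
qed

lemma pd_mult:
  assumes "C1_on S f" "C1_on S g" "x \<in> S"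
  shows "pd i (\<lambda>x. f x * g x) x = pd i f x * g x + f x * pd i g x"
  using pd_eq[OF has_derivative_mult[OF C1_on_differentiable[OF assms(1,3)] C1_on_differentiable[OF assms(2,3)]]]
  by (simp add: pd_def)

lemma pd_sum:
  assumes "\<And>j. j \<in> I \<Longrightarrow> C1_on S (f j)" "x \<in> S"
  shows "pd i (\<lambda>x. \<Sum>j\<in>I. c j * f j x) x = (\<Sum>j\<in>I. c j * pd i (f j) x)"
  using pd_eq[OF has_derivative_sum[of I "\<lambda>j x. c j * f j x", OF has_derivative_mult_right[OF C1_on_differentiable[OF assms(1) assms(2)]]]]
  by (simp add: pd_def)

lemma C1_extend_zero:
  fixes f :: "real^'n::finite \<Rightarrow> real"
  assumes "open \<Omega>" "C1_on \<Omega> f" "compact K" "K \<subseteq> \<Omega>" "\<And>x. x \<notin> K \<Longrightarrow> f x = 0"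
  shows "C1_on UNIV f"
proof -
  obtain D where D: "\<And>x. x \<in> \<Omega> \<Longrightarrow> (f has_derivative blinfun_apply (D x)) (at x)" "continuous_on \<Omega> D"
    using C1_onE[OF assms(2)] by metis
  have cK: "closed K" using assms(3) by (rule compact_imp_closed)
  have out: "(f has_derivative (\<lambda>h. 0)) (at x)" if "x \<notin> K" for x
    by (rule has_derivative_transform_within_open[of "\<lambda>x. 0" _ _ _ "- K"]) (use assms(5) cK that in auto)
  \<comment> \<open>On the part of \<open>\<Omega>\<close> outside \<open>K\<close> the derivative
    is already zero, so \<open>?D\<close> agrees with \<open>D\<close> on all of
    \<open>\<Omega>\<close>; continuity is then checked on the open cover by \<open>\<Omega>\<close>
    and the complement of \<open>K\<close>.\<close>
  let ?D = "\<lambda>x. if x \<in> K then D x else 0"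
  have eq: "D x = ?D x" if "x \<in> \<Omega>" for x
    using has_derivative_unique[OF D(1)[OF that] out]
    by (auto intro!: blinfun_eqI)
  have "continuous_on \<Omega> ?D" by (rule continuous_on_eq[OF D(2) eq])
  moreover have "continuous_on (- K) ?D"
    by (rule continuous_on_eq[of _ "\<lambda>x. 0"]) auto
  ultimately have "continuous_on (\<Omega> \<union> - K) ?D"
    using assms(1) cK by (intro continuous_on_open_Un) auto
  moreover have "\<Omega> \<union> - K = UNIV" using assms(4) by auto
  moreover have "(f has_derivative blinfun_apply (?D x)) (at x)" for x
    using D(1)[of x] out[of x] assms(4) by (cases "x \<in> K") (auto simp: zero_blinfun.rep_eq)
  ultimately show ?thesis unfolding C1_on_def by (intro exI[of _ ?D]) auto
qed

section \<open>Cartan's formula and the non-involutivity set\<close>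

locale projected_distribution =
  fixes \<Omega> :: "(real^'n::finite) set" and V :: "real^'n \<Rightarrow> (real^'n) set" and P :: "real^'n \<Rightarrow> real^'n^'n"
  assumes open_dom: "open \<Omega>" and C1_P: "C1_on \<Omega> P" and proj: "\<And>x. x \<in> \<Omega> \<Longrightarrow> is_proj (P x) (V x)"
begin

abbreviation "nu r x \<equiv> conormal (P x) r"

text \<open>The plain matrix of partial derivatives. Antisymmetrization is supplied by the context:
  either two orders of the arguments are compared, or the matrix is contracted with an alternating
  family.\<close>

definition dnu :: "'n \<Rightarrow> real^'n \<Rightarrow> 'n \<Rightarrow> 'n \<Rightarrow> real" where
  "dnu r x i a = pd i (\<lambda>y. nu r y $ a) x"

lemma C1_apply: "C1_on \<Omega> (\<lambda>y. P y *v u)"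
proof (rule C1_on_linear[OF C1_P])
  have "linear (\<lambda>M :: real^'n^'n. M *v u)"
    by (intro linearI) (simp_all add: matrix_vector_mult_add_rdistrib scaleR_matrix_vector_assoc)
  then show "bounded_linear (\<lambda>M :: real^'n^'n. M *v u)"
    by (simp add: linear_conv_bounded_linear)
qed

lemma C1_nu: "C1_on \<Omega> (nu r)"
proof -
  have "C1_on \<Omega> (\<lambda>y. axis r 1 + - 1 *\<^sub>R (P y *v axis r 1))"
    by (intro C1_on_add C1_on_const C1_on_linear[OF C1_apply] bounded_linear_scaleR_right)
  then show ?thesis by (simp add: conormal_def[abs_def])
qed

lemma C1_nu_nth: "C1_on \<Omega> (\<lambda>y. nu r y $ a)"
  by (intro C1_on_linear[OF C1_nu] bounded_linear_vec_nth)

lemma dnu_continuous: "continuous_on \<Omega> (\<lambda>x. dnu r x i a)"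
  unfolding dnu_def by (rule C1_on_pd_continuous[OF C1_nu_nth])

lemma dnu_eq:
  assumes "x \<in> \<Omega>"
  shows "frechet_derivative (nu r) (at x) u $ a = (\<Sum>i\<in>UNIV. u $ i * dnu r x i a)"
proof -
  let ?D = "frechet_derivative (nu r) (at x)"
  have D: "(nu r has_derivative ?D) (at x)" by (rule C1_on_differentiable[OF C1_nu assms])
  have lin: "linear ?D" by (rule has_derivative_linear[OF D])
  have "dnu r x i a = ?D (axis i 1) $ a" for i
    unfolding dnu_def
    by (rule pd_eq[OF bounded_linear.has_derivative[OF bounded_linear_vec_nth D]])
  moreover have "?D u = (\<Sum>i\<in>UNIV. u $ i *\<^sub>R ?D (axis i 1))"
  proof -
    have "u = (\<Sum>i\<in>UNIV. u $ i *\<^sub>R axis i 1)"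
      using basis_expansion[of u] by (simp add: scalar_mult_eq_scaleR)
    then have "?D u = ?D (\<Sum>i\<in>UNIV. u $ i *\<^sub>R axis i 1)" by (rule arg_cong)
    then show ?thesis by (simp add: linear_sum[OF lin] linear_scale[OF lin])
  qed
  ultimately show ?thesis by (simp add: sum_component)
qed

text \<open>Differentiating \<open>nu \<bullet> w = 0\<close>, the key step of Cartan's formula.\<close>

lemma dnu_tangent:
  assumes "tangent_field \<Omega> V w" "x \<in> \<Omega>"
  shows "(\<Sum>i\<in>UNIV. \<Sum>a\<in>UNIV. dnu r x i a * u $ i * w x $ a) = - (nu r x \<bullet> frechet_derivative w (at x) u)"
proof -
  let ?D = "frechet_derivative (nu r) (at x)" and ?E = "frechet_derivative w (at x)"
  have w: "C1_on \<Omega> w" "\<And>y. y \<in> \<Omega> \<Longrightarrow> w y \<in> V y" using assms(1) by (auto simp: tangent_field_def)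
  have "((\<lambda>y. nu r y \<bullet> w y) has_derivative (\<lambda>h. nu r x \<bullet> ?E h + ?D h \<bullet> w x)) (at x)"
    by (rule has_derivative_inner[OF C1_on_differentiable[OF C1_nu assms(2)] C1_on_differentiable[OF w(1) assms(2)]])
  moreover have "((\<lambda>y. nu r y \<bullet> w y) has_derivative (\<lambda>h. 0)) (at x)"
    by (rule has_derivative_transform_within_open[of "\<lambda>x. 0" _ _ _ \<Omega>])
       (use assms(2) open_dom conormal_inner[OF proj w(2)] in auto)
  ultimately have "nu r x \<bullet> ?E u + ?D u \<bullet> w x = 0"
    using has_derivative_unique by (metis (no_types, lifting))
  moreover have "?D u \<bullet> w x = (\<Sum>a\<in>UNIV. \<Sum>i\<in>UNIV. dnu r x i a * u $ i * w x $ a)"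
    unfolding inner_vec_def dnu_eq[OF assms(2)] by (simp add: sum_distrib_left sum_distrib_right mult_ac)
  ultimately show ?thesis by (subst sum.swap) simp
qed

text \<open>Cartan's formula for fields annihilated by \<open>nu\<close>: the terms differentiating
  \<open>nu \<bullet> w\<close> and \<open>nu \<bullet> w'\<close> vanish. The sign reflects the
  convention of \<open>lie_bracket\<close>, opposite to that of the commutator of
  derivations.\<close>

lemma nu_lie_bracket:
  assumes "tangent_field \<Omega> V w" "tangent_field \<Omega> V w'" "x \<in> \<Omega>"
  shows "nu r x \<bullet> lie_bracket w w' x = (\<Sum>i\<in>UNIV. \<Sum>a\<in>UNIV. dnu r x i a * w x $ i * w' x $ a)
     - (\<Sum>i\<in>UNIV. \<Sum>a\<in>UNIV. dnu r x i a * w' x $ i * w x $ a)"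
  unfolding dnu_tangent[OF assms(1,3)] dnu_tangent[OF assms(2,3)]
  by (simp add: lie_bracket_def inner_diff_right)

text \<open>By Cartan's formula the normal part of a bracket at \<open>x\<close> depends only on the
  values of the two fields at \<open>x\<close>, so one pair of fields for each pair of values
  suffices.\<close>

lemma involutive_at_iff:
  assumes x: "x \<in> \<Omega>"
  shows "involutive_at \<Omega> V x \<longleftrightarrow> (\<forall>r. \<forall>u\<in>V x. \<forall>v\<in>V x.
    (\<Sum>i\<in>UNIV. \<Sum>a\<in>UNIV. dnu r x i a * u $ i * v $ a) = (\<Sum>i\<in>UNIV. \<Sum>a\<in>UNIV. dnu r x i a * v $ i * u $ a))"
    (is "_ \<longleftrightarrow> ?R")
proof
  assume inv: "involutive_at \<Omega> V x"
  show ?R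
  proof (intro allI ballI)
    fix r u v assume uv: "u \<in> V x" "v \<in> V x"
    \<comment> \<open>Projecting a constant vector \<open>u\<close> gives a C1 tangent field, whose
      value at \<open>x\<close> is \<open>u\<close> itself when \<open>u\<close> lies in
      \<open>V x\<close>.\<close>
    have t: "tangent_field \<Omega> V (\<lambda>y. P y *v u)" for u
      using C1_apply proj unfolding tangent_field_def is_proj_def by blast
    have "lie_bracket (\<lambda>y. P y *v u) (\<lambda>y. P y *v v) x \<in> V x"
      using inv t unfolding involutive_at_def by blast
    then have "nu r x \<bullet> lie_bracket (\<lambda>y. P y *v u) (\<lambda>y. P y *v v) x = 0"
      by (rule conormal_inner[OF proj[OF x]])
    then show "(\<Sum>i\<in>UNIV. \<Sum>a\<in>UNIV. dnu r x i a * u $ i * v $ a) = (\<Sum>i\<in>UNIV. \<Sum>a\<in>UNIV. dnu r x i a * v $ i * u $ a)"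
      unfolding nu_lie_bracket[OF t t x] is_proj_fixed[OF proj[OF x] uv(1)] is_proj_fixed[OF proj[OF x] uv(2)]
      by simp
  qed
next
  assume R: ?R
  show "involutive_at \<Omega> V x"
    unfolding involutive_at_def
  proof (intro allI impI)
    fix w w' assume t: "tangent_field \<Omega> V w \<and> tangent_field \<Omega> V w'"
    then have "w x \<in> V x" "w' x \<in> V x" using x by (auto simp: tangent_field_def)
    then have "nu r x \<bullet> lie_bracket w w' x = 0" for r
      using R nu_lie_bracket[OF conjunct1[OF t] conjunct2[OF t] x] by simp
    then show "lie_bracket w w' x \<in> V x" using mem_iff_conormal[OF proj[OF x]] by simp
  qed
qed

text \<open>The pair of fields and the conormal that detect non-involutivity at \<open>x\<close>
  also detect it nearby, since \<open>nu r y \<bullet> lie_bracket w w' y\<close> is continuous in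
  \<open>y\<close>.\<close>

lemma open_noninv: "open (noninv \<Omega> V)"
proof (subst open_subopen, rule ballI)
  fix x assume "x \<in> noninv \<Omega> V"
  then obtain w w' where x: "x \<in> \<Omega>" and t: "tangent_field \<Omega> V w" "tangent_field \<Omega> V w'"
    and "lie_bracket w w' x \<notin> V x"
    by (auto simp: noninv_def involutive_at_def)
  then obtain r where r: "nu r x \<bullet> lie_bracket w w' x \<noteq> 0"
    using mem_iff_conormal[OF proj[OF x]] by blast
  let ?h = "\<lambda>y. nu r y \<bullet> lie_bracket w w' y"
  have "continuous_on \<Omega> ?h"
    unfolding lie_bracket_def using t unfolding tangent_field_def
    by (intro continuous_intros C1_on_continuous[OF C1_nu] C1_on_frechet_continuous C1_on_continuous) auto
  then have "open (\<Omega> \<inter> ?h -` (- {0}))"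
    by (intro continuous_open_preimage open_dom) auto
  moreover have "\<Omega> \<inter> ?h -` (- {0}) \<subseteq> noninv \<Omega> V"
    using t conormal_inner[OF proj] unfolding noninv_def involutive_at_def by blast
  ultimately show "\<exists>T. open T \<and> x \<in> T \<and> T \<subseteq> noninv \<Omega> V" using x r by blast
qed

lemma involutive_at_iff_contraction:
  assumes "x \<in> \<Omega>" "is_mv k v" "v \<noteq> (\<lambda>_. 0)" "mvspan k v = V x" "dim (V x) = k"
  shows "involutive_at \<Omega> V x \<longleftrightarrow> (\<forall>r q. (\<Sum>i\<in>UNIV. \<Sum>a\<in>UNIV. dnu r x i a * v (i # a # q)) = 0)"
proof -
  have W: "subspace (V x)" using proj[OF assms(1)] by (simp add: is_proj_def)
  have contr: "a \<in> contr v" if "\<forall>w\<in>V x. a \<bullet> w = 0" for a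
    using mvspan_subset_iff[OF assms(2) W] assms(4) that by (auto simp: orthogonal_comp_mem_iff)
  show ?thesis
    unfolding involutive_at_iff[OF assms(1)]
  proof (intro iffI allI ballI)
    fix r q
    assume "\<forall>r. \<forall>u\<in>V x. \<forall>v\<in>V x.
      (\<Sum>i\<in>UNIV. \<Sum>a\<in>UNIV. dnu r x i a * u $ i * v $ a) = (\<Sum>i\<in>UNIV. \<Sum>a\<in>UNIV. dnu r x i a * v $ i * u $ a)"
    then show "(\<Sum>i\<in>UNIV. \<Sum>a\<in>UNIV. dnu r x i a * v (i # a # q)) = 0"
      by (intro contraction2_symmetric[OF W assms(2) contr]) auto
  next
    fix r y z
    assume "\<forall>r q. (\<Sum>i\<in>UNIV. \<Sum>a\<in>UNIV. dnu r x i a * v (i # a # q)) = 0" "y \<in> V x" "z \<in> V x"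
    then show "(\<Sum>i\<in>UNIV. \<Sum>a\<in>UNIV. dnu r x i a * y $ i * z $ a) = (\<Sum>i\<in>UNIV. \<Sum>a\<in>UNIV. dnu r x i a * z $ i * y $ a)"
      by (intro contraction2_zero_imp_symmetric[OF W assms(5,2,3) contr]) auto
  qed
qed

end

section \<open>Currents tangent to a distribution\<close>

text \<open>Moving the differentiated index to the front absorbs the sign, after which all
  \<open>Suc m\<close> positions contribute the same sum; this reduces \<open>fact (Suc m)\<close>
  to \<open>fact m\<close>.\<close>

lemma pair_dform:
  fixes v :: "'n::finite list \<Rightarrow> real"
  assumes "is_mv (Suc m) v"
  shows "pair (Suc m) (dform (Suc m) \<omega> x) v
    = (\<Sum>i\<in>UNIV. \<Sum>l | length l = m. pd i (\<lambda>y. \<omega> y l) x * v (i # l)) / fact m"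
proof -
  let ?g = "\<lambda>i l. pd i (\<lambda>y. \<omega> y l) x * v (i # l)"
  have "(\<Sum>l | length l = Suc m. dform (Suc m) \<omega> x l * v l)
    = (\<Sum>l | length l = Suc m. \<Sum>j<Suc m. ?g (l ! j) (take j l @ drop (Suc j) l))"
  proof (rule sum.cong[OF refl])
    fix l :: "'n list" assume "l \<in> {l. length l = Suc m}"
    then have l: "length l = Suc m" by simp
    have "(-1) ^ j * v l = v (l ! j # take j l @ drop (Suc j) l)" if "j < Suc m" for j
    proof -
      have "v l = v (take j l @ l ! j # drop (Suc j) l)"
        using id_take_nth_drop[of j l] that l by simp
      also have "\<dots> = (-1) ^ j * v (l ! j # take j l @ drop (Suc j) l)"
        using is_mv_front[OF assms, of "take j l"] that l by simp
      finally show ?thesis by (simp flip: mult.assoc power_mult_distrib)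
    qed
    then have "(-1) ^ j * pd (l ! j) (\<lambda>y. \<omega> y (take j l @ drop (Suc j) l)) x * v l
        = ?g (l ! j) (take j l @ drop (Suc j) l)" if "j < Suc m" for j
      using that by (simp add: mult.commute mult.left_commute)
    then show "dform (Suc m) \<omega> x l * v l = (\<Sum>j<Suc m. ?g (l ! j) (take j l @ drop (Suc j) l))"
      unfolding dform_def using l by (simp only: sum_distrib_right if_True refl) (intro sum.cong, auto)
  qed
  also have "\<dots> = (\<Sum>j<Suc m. \<Sum>l | length l = Suc m. ?g (l ! j) (take j l @ drop (Suc j) l))"
    by (rule sum.swap)
  also have "\<dots> = (\<Sum>j<Suc m. \<Sum>i\<in>UNIV. \<Sum>l | length l = m. ?g i l)"
    by (intro sum.cong refl sum_lists_insert) auto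
  finally show ?thesis by (simp add: pair_def)
qed

text \<open>The alternating sum of \<open>front F q\<close> is the covector \<open>F\<close> wedged with the basis covectors
  of \<open>q\<close>, up to a constant.\<close>

definition front :: "('n \<Rightarrow> real) \<Rightarrow> 'n list \<Rightarrow> 'n list \<Rightarrow> real" where
  "front F q l = (case l of [] \<Rightarrow> 0 | a # l' \<Rightarrow> if l' = q then F a else 0)"

lemma sum_front:
  fixes t :: "'n::finite list \<Rightarrow> real"
  assumes "is_mv m t"
  shows "(\<Sum>l | length l = m. front F q l * t l) = (\<Sum>a\<in>UNIV. F a * t (a # q))"
proof (cases "m = Suc (length q)")
  case True
  have "(\<Sum>l | length l = m. front F q l * t l)
      = (\<Sum>a\<in>UNIV. \<Sum>l | length l = length q. if l = q then F a * t (a # q) else 0)"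
    unfolding True sum_lists_UNIV_Suc front_def by (intro sum.cong refl) auto
  then show ?thesis by simp
next
  \<comment> \<open>If \<open>q\<close> has the wrong length both sides vanish, so \<open>q\<close>
    may range over all lists later on.\<close>
  case False
  have "front F q l * t l = 0" if "length l = m" for l
    using False that by (auto simp: front_def split: list.split)
  moreover have "t (a # q) = 0" for a using is_mv_length[OF assms] False by simp
  ultimately show ?thesis by (simp add: sum.neutral)
qed

lemma pair_altsum_front:
  assumes "is_mv m t"
  shows "pair m (altsum m (front F q)) t = (\<Sum>a\<in>UNIV. F a * t (a # q))"
  by (simp add: pair_def sum_altsum_mult[OF assms] sum_front[OF assms])

lemma pd_const: "pd i (\<lambda>y :: real^'n::finite. c) x = 0"
  using pd_eq[of "\<lambda>y. c" "\<lambda>h. 0" x i] by simp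

lemma C1_front: "(\<And>a. C1_on S (\<lambda>y. F y a)) \<Longrightarrow> C1_on S (\<lambda>y. front (F y) q l)"
  by (cases l; cases "tl l = q") (auto simp: front_def C1_on_const)

lemma pd_front: "pd i (\<lambda>y. front (F y) q l) x = front (\<lambda>a. pd i (\<lambda>y. F y a) x) q l"
  by (cases l) (auto simp: front_def pd_const)

lemma C1_altsum:
  assumes "\<And>l. C1_on S (\<lambda>y. g y l)"
  shows "C1_on S (\<lambda>y. altsum m (g y) l)"
proof (cases "length l = m")
  case True
  then show ?thesis
    unfolding altsum_def
    by (auto intro!: C1_on_sum finite_permutations C1_on_mult_real C1_on_const assms)
qed (simp add: altsum_def C1_on_const)

lemma pd_altsum:
  fixes g :: "real^'n::finite \<Rightarrow> 'n list \<Rightarrow> real"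
  assumes "\<And>l. C1_on UNIV (\<lambda>y. g y l)"
  shows "pd i (\<lambda>y. altsum m (g y) l) x = altsum m (\<lambda>l. pd i (\<lambda>y. g y l) x) l"
proof (cases "length l = m")
  case True
  then show ?thesis
    unfolding altsum_def by (simp add: pd_sum[OF assms UNIV_I])
qed (simp add: altsum_def pd_const)

text \<open>Applied to \<open>nu\<close> and \<open>dnu\<close>, which are controlled on
  \<open>\<Omega>\<close> only; cutting off at a compact \<open>K\<close> makes the coefficient
  bounded and measurable.\<close>

lemma integrable_continuous_on_compact_mult:
  fixes c f :: "'a::euclidean_space \<Rightarrow> real"
  assumes M: "sets M = sets borel" and "compact K" "continuous_on K c" "integrable M f"
  shows "integrable M (\<lambda>x. indicator K x * (c x * f x))"
proof -
  have "compact (c ` K)" by (rule compact_continuous_image[OF assms(3,2)])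
  then obtain C where C: "\<And>y. y \<in> c ` K \<Longrightarrow> norm y \<le> C"
    using compact_imp_bounded bounded_iff by metis
  have "(\<lambda>x. indicator K x *\<^sub>R c x) \<in> borel_measurable borel"
    using assms(2,3) by (intro borel_measurable_continuous_on_indicator) (auto intro: borel_compact)
  then have cm: "(\<lambda>x. indicator K x *\<^sub>R c x) \<in> borel_measurable M"
    by (simp cong: measurable_cong_sets add: M)
  show ?thesis
  proof (rule Bochner_Integration.integrable_bound)
    show "integrable M (\<lambda>x. C * f x)" using assms(4) by simp
    have "(\<lambda>x. (indicator K x *\<^sub>R c x) * f x) \<in> borel_measurable M"
      using assms(4) by (intro borel_measurable_times cm) auto
    then show "(\<lambda>x. indicator K x * (c x * f x)) \<in> borel_measurable M" by (simp add: mult.assoc)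
    show "AE x in M. norm (indicator K x * (c x * f x)) \<le> norm (C * f x)"
    proof (rule AE_I2)
      fix x
      show "norm (indicator K x * (c x * f x)) \<le> norm (C * f x)"
      proof (cases "x \<in> K")
        case True
        then have "\<bar>c x\<bar> \<le> \<bar>C\<bar>" using C[of "c x"] by simp
        then show ?thesis using True by (simp add: abs_mult mult_right_mono)
      qed simp
    qed
  qed
qed

lemma borel_measurable_pair:
  assumes M: "sets M = sets borel" and "\<And>l. integrable M (\<lambda>x. \<tau> x l)"
    and "\<And>l. continuous_on UNIV (\<lambda>x. c x l)"
  shows "(\<lambda>x. pair h (c x) (\<tau> x)) \<in> borel_measurable M"
proof -
  have "(\<lambda>x. c x l) \<in> borel_measurable M" "(\<lambda>x. \<tau> x l) \<in> borel_measurable M" for l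
    using assms(2) continuous_imp_borel_measurable[OF M assms(3)] by auto
  then show ?thesis
    unfolding pair_def
    by (intro borel_measurable_divide borel_measurable_sum borel_measurable_times) auto
qed

context projected_distribution
begin

text \<open>For the form \<open>\<eta> nu \<and> dx_q\<close> the exterior derivative has the two
  terms \<open>d\<eta> \<and> nu \<and> dx_q\<close> and \<open>\<eta> d nu \<and> dx_q\<close>. The
  first pairs to zero with \<open>\<tau>\<close>, which \<open>nu\<close> annihilates, so no
  derivative of \<open>\<eta>\<close> survives and the identity can be localized.\<close>

lemma boundary_contraction:
  assumes T: "normal_current_repr \<Omega> k \<mu> \<tau> \<mu>' \<tau>'" and k: "1 \<le> k"
    and tan: "AE x in \<mu>. \<forall>r. nu r x \<in> contr (\<tau> x)"
    and \<eta>: "C1_on UNIV \<eta>" and K: "compact K" "K \<subseteq> \<Omega>" "\<And>x. x \<notin> K \<Longrightarrow> \<eta> x = 0"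
  shows "(\<integral>x. \<eta> x * (\<Sum>i\<in>UNIV. \<Sum>a\<in>UNIV. dnu r x i a * \<tau> x (i # a # q)) \<partial>\<mu>)
    = (\<integral>x. \<eta> x * (\<Sum>a\<in>UNIV. nu r x $ a * \<tau>' x (a # q)) \<partial>\<mu>')"
proof -
  obtain m where m: "k = Suc m" using k by (cases k) auto
  have M: "sets \<mu> = sets borel" "sets \<mu>' = sets borel"
    and int: "\<And>l. integrable \<mu> (\<lambda>x. \<tau> x l)" "\<And>l. integrable \<mu>' (\<lambda>x. \<tau>' x l)"
    and mv: "AE x in \<mu>. is_mv k (\<tau> x)" "AE x in \<mu>'. is_mv (k - 1) (\<tau>' x)"
    using T unfolding normal_current_repr_def finite_measure_on_def by auto
  define \<phi> where "\<phi> x a = \<eta> x * nu r x $ a" for x a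
  have C\<phi>: "C1_on UNIV (\<lambda>x. \<phi> x a)" for a
  proof (rule C1_extend_zero[OF open_dom _ K(1,2)])
    show "C1_on \<Omega> (\<lambda>x. \<phi> x a)"
      unfolding \<phi>_def by (intro C1_on_mult_real C1_nu_nth C1_on_subset[OF \<eta>]) auto
  qed (simp add: \<phi>_def K(3))
  \<comment> \<open>Antisymmetrizing makes the form alternating as \<open>boundary_C1_form\<close>
    requires; its factor \<open>fact m\<close> cancels against \<open>pair\<close> in
    \<open>pair_altsum_front\<close>.\<close>
  define \<omega> where "\<omega> x = altsum m (front (\<phi> x) q)" for x
  have C\<omega>: "C1_on UNIV (\<lambda>x. \<omega> x l)" for l
    unfolding \<omega>_def by (intro C1_altsum C1_front C\<phi>)
  have \<omega>0: "\<omega> x l = 0" if "x \<notin> K" for x l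
  proof -
    have "front (\<phi> x) q l = 0" for l using K(3)[OF that] by (cases l) (auto simp: front_def \<phi>_def)
    then show ?thesis by (simp add: \<omega>_def altsum_def)
  qed
  have "(\<integral>x. pair k (dform k \<omega> x) (\<tau> x) \<partial>\<mu>) = (\<integral>x. pair (k - 1) (\<omega> x) (\<tau>' x) \<partial>\<mu>')"
    by (rule boundary_C1_form[OF open_dom T _ C\<omega> K(1,2) \<omega>0])
       (auto simp: \<omega>_def m is_mv_altsum)
  moreover have "(\<integral>x. pair k (dform k \<omega> x) (\<tau> x) \<partial>\<mu>)
    = (\<integral>x. \<eta> x * (\<Sum>i\<in>UNIV. \<Sum>a\<in>UNIV. dnu r x i a * \<tau> x (i # a # q)) \<partial>\<mu>)"
  proof (rule integral_cong_AE)
    have "continuous_on UNIV (\<lambda>x. dform k \<omega> x l)" for l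
      unfolding dform_def
      by (cases "length l = k") (auto intro!: continuous_intros C1_on_pd_continuous C\<omega>)
    then show "(\<lambda>x. pair k (dform k \<omega> x) (\<tau> x)) \<in> borel_measurable \<mu>"
      by (intro borel_measurable_pair M int)
    have "(\<lambda>x. \<Sum>i\<in>UNIV. \<Sum>a\<in>UNIV. \<eta> x * (indicator K x * (dnu r x i a * \<tau> x (i # a # q)))) \<in> borel_measurable \<mu>"
      by (intro borel_measurable_sum
          borel_measurable_times[OF continuous_imp_borel_measurable[OF M(1) C1_on_continuous[OF \<eta>]]]
          borel_measurable_integrable integrable_continuous_on_compact_mult
          M(1) K(1) continuous_on_subset[OF dnu_continuous K(2)] int(1))
    moreover have "\<eta> x * (indicator K x * s) = \<eta> x * s" for x s
      using K(3)[of x] by (cases "x \<in> K") auto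
    ultimately show "(\<lambda>x. \<eta> x * (\<Sum>i\<in>UNIV. \<Sum>a\<in>UNIV. dnu r x i a * \<tau> x (i # a # q))) \<in> borel_measurable \<mu>"
      by (simp add: sum_distrib_left)
    show "AE x in \<mu>. pair k (dform k \<omega> x) (\<tau> x)
      = \<eta> x * (\<Sum>i\<in>UNIV. \<Sum>a\<in>UNIV. dnu r x i a * \<tau> x (i # a # q))"
      using mv(1) tan
    proof eventually_elim
      case (elim x)
      have mvx: "is_mv (Suc m) (\<tau> x)" using elim m by simp
      have pd\<omega>: "pd i (\<lambda>y. \<omega> y l) x = altsum m (front (\<lambda>a. pd i (\<lambda>y. \<phi> y a) x) q) l" for i l
        unfolding \<omega>_def by (subst pd_altsum) (auto intro: C1_front C\<phi> simp: pd_front)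
      have "pair k (dform k \<omega> x) (\<tau> x) = (\<Sum>i\<in>UNIV. pair m (altsum m (front (\<lambda>a. pd i (\<lambda>y. \<phi> y a) x) q)) (\<lambda>l. \<tau> x (i # l)))"
        unfolding m pair_dform[OF mvx] pd\<omega> by (simp add: pair_def sum_divide_distrib)
      also have "\<dots> = (\<Sum>i\<in>UNIV. \<Sum>a\<in>UNIV. pd i (\<lambda>y. \<phi> y a) x * \<tau> x (i # a # q))"
        by (simp add: pair_altsum_front[OF is_mv_Cons[OF mvx]])
      also have "\<dots> = \<eta> x * (\<Sum>i\<in>UNIV. \<Sum>a\<in>UNIV. dnu r x i a * \<tau> x (i # a # q))"
      proof (cases "x \<in> K")
        case True
        then have x: "x \<in> \<Omega>" using K(2) by auto
        have "pd i (\<lambda>y. \<phi> y a) x = pd i \<eta> x * nu r x $ a + \<eta> x * dnu r x i a" for i a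
          unfolding \<phi>_def dnu_def by (intro pd_mult[OF C1_on_subset[OF \<eta>] C1_nu_nth x]) auto
        then have "(\<Sum>i\<in>UNIV. \<Sum>a\<in>UNIV. pd i (\<lambda>y. \<phi> y a) x * \<tau> x (i # a # q))
          = (\<Sum>i\<in>UNIV. pd i \<eta> x * (\<Sum>a\<in>UNIV. nu r x $ a * \<tau> x (i # a # q)))
            + \<eta> x * (\<Sum>i\<in>UNIV. \<Sum>a\<in>UNIV. dnu r x i a * \<tau> x (i # a # q))"
          by (simp add: distrib_right sum.distrib sum_distrib_left mult.assoc)
        \<comment> \<open>Here \<open>d\<eta>\<close> occupies the first slot and \<open>nu\<close>
          the second, so tangency is used in the form for slices.\<close>
        moreover have "(\<Sum>a\<in>UNIV. nu r x $ a * \<tau> x (i # a # q)) = 0" for i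
          using sum_contr[OF mem_contr_second[OF mvx]] elim(2) by blast
        ultimately show ?thesis by simp
      next
        \<comment> \<open>Outside \<open>K\<close> the coefficients vanish on an open set, and
          \<open>\<eta> x = 0\<close> suppresses whatever value \<open>dnu\<close> takes where
          \<open>P\<close> is not controlled.\<close>
        case False
        have "pd i (\<lambda>y. \<phi> y a) x = 0" for i a
          by (rule pd_zero_outside[OF compact_imp_closed[OF K(1)] _ False]) (simp add: \<phi>_def K(3))
        then show ?thesis using K(3)[OF False] by simp
      qed
      finally show ?case .
    qed
  qed
  moreover have "(\<integral>x. pair (k - 1) (\<omega> x) (\<tau>' x) \<partial>\<mu>')
    = (\<integral>x. \<eta> x * (\<Sum>a\<in>UNIV. nu r x $ a * \<tau>' x (a # q)) \<partial>\<mu>')"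
  proof (rule integral_cong_AE)
    show "(\<lambda>x. pair (k - 1) (\<omega> x) (\<tau>' x)) \<in> borel_measurable \<mu>'"
      by (intro borel_measurable_pair M int C1_on_continuous C\<omega>)
    have "(\<lambda>x. \<Sum>a\<in>UNIV. \<phi> x a * \<tau>' x (a # q)) \<in> borel_measurable \<mu>'"
      using int(2)
      by (intro borel_measurable_sum borel_measurable_times
          continuous_imp_borel_measurable[OF M(2) C1_on_continuous[OF C\<phi>]]) auto
    then show "(\<lambda>x. \<eta> x * (\<Sum>a\<in>UNIV. nu r x $ a * \<tau>' x (a # q))) \<in> borel_measurable \<mu>'"
      by (simp add: \<phi>_def sum_distrib_left mult.assoc)
    show "AE x in \<mu>'. pair (k - 1) (\<omega> x) (\<tau>' x) = \<eta> x * (\<Sum>a\<in>UNIV. nu r x $ a * \<tau>' x (a # q))"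
      using mv(2)
    proof eventually_elim
      case (elim x)
      then show ?case
        unfolding \<omega>_def m by (simp add: pair_altsum_front \<phi>_def sum_distrib_left mult.assoc)
    qed
  qed
  ultimately show ?thesis by simp
qed

end

section \<open>From test integrals to null sets and supports\<close>

lemma AE_zero_iff_test:
  fixes g :: "real^'n::finite \<Rightarrow> real"
  assumes M: "sets M = sets borel" "finite_measure M" "open \<Omega>"
    and int: "\<forall>K. compact K \<longrightarrow> K \<subseteq> \<Omega> \<longrightarrow> integrable M (\<lambda>x. indicator K x * g x)"
  shows "(AE x in M. x \<in> \<Omega> \<longrightarrow> g x = 0) \<longleftrightarrow> (\<forall>\<eta> K. C1_on UNIV \<eta> \<longrightarrow> compact K \<longrightarrow> K \<subseteq> \<Omega> \<longrightarrow>
    (\<forall>x. x \<notin> K \<longrightarrow> \<eta> x = 0) \<longrightarrow> (\<integral>x. \<eta> x * g x \<partial>M) = 0)"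
proof (intro iffI allI impI)
  fix \<eta> :: "real^'n \<Rightarrow> real" and K
  assume g: "AE x in M. x \<in> \<Omega> \<longrightarrow> g x = 0" and K: "K \<subseteq> \<Omega>" "\<forall>x. x \<notin> K \<longrightarrow> \<eta> x = 0"
  have "AE x in M. \<eta> x * g x = 0" using g by eventually_elim (use K in auto)
  then show "(\<integral>x. \<eta> x * g x \<partial>M) = 0" by (rule integral_eq_zero_AE)
next
  assume "\<forall>\<eta> K. C1_on UNIV \<eta> \<longrightarrow> compact K \<longrightarrow> K \<subseteq> \<Omega> \<longrightarrow>
    (\<forall>x. x \<notin> K \<longrightarrow> \<eta> x = 0) \<longrightarrow> (\<integral>x. \<eta> x * g x \<partial>M) = 0"
  then show "AE x in M. x \<in> \<Omega> \<longrightarrow> g x = 0"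
    using int by (intro AE_zero_of_test[OF M]) auto
qed

text \<open>The complement of the support is a union of null balls; the Lindelof property reduces it
  to a countable union, which is null. Conversely, a ball inside a null open set has measure zero,
  so its centre is not in the support.\<close>

lemma AE_notin_iff_msupp_disjoint:
  fixes M :: "(real^'n::finite) measure"
  assumes M: "sets M = sets borel" and N: "open N"
  shows "(AE x in M. x \<notin> N) \<longleftrightarrow> msupp M \<inter> N = {}"
proof -
  have sp: "space M = UNIV" using sets_eq_imp_space_eq[OF M] by simp
  have Nm: "N \<in> sets M" using N by (simp add: M)
  have AE_eq: "(AE x in M. x \<notin> A) \<longleftrightarrow> emeasure M A = 0" if "A \<in> sets M" for A
    using that by (subst AE_iff_measurable[of A]) (auto simp: sp)
  show ?thesis
  proof
    assume "AE x in M. x \<notin> N"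
    then have 0: "emeasure M N = 0" using AE_eq[OF Nm] by simp
    show "msupp M \<inter> N = {}"
    proof (rule ccontr)
      assume "msupp M \<inter> N \<noteq> {}"
      then obtain x r where x: "x \<in> msupp M" "r > 0" "ball x r \<subseteq> N"
        using N by (meson disjoint_iff open_contains_ball)
      then have "emeasure M (ball x r) \<le> emeasure M N" by (intro emeasure_mono Nm)
      then show False using x 0 by (auto simp: msupp_def)
    qed
  next
    assume disj: "msupp M \<inter> N = {}"
    let ?F = "{ball x r | x r. emeasure M (ball x r) = 0}"
    obtain F where F: "F \<subseteq> ?F" "countable F" "\<Union>F = \<Union>?F"
      using Lindelof[of ?F] by blast
    have "AE x in M. \<forall>B\<in>F. x \<notin> B"
    proof (rule AE_ball_countable'[OF _ F(2)])
      fix B assume "B \<in> F"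
      then obtain x r where "B = ball x r" "emeasure M (ball x r) = 0" using F(1) by blast
      then show "AE x in M. x \<notin> B" using AE_eq[of B] by (simp add: M)
    qed
    moreover have "N \<subseteq> \<Union>F"
    proof
      fix x assume "x \<in> N"
      then have "x \<notin> msupp M" using disj by auto
      then obtain r where "r > 0" "emeasure M (ball x r) = 0" by (auto simp: msupp_def)
      then show "x \<in> \<Union>F" unfolding F(3) by (intro UnionI[of "ball x r"]) auto
    qed
    ultimately show "AE x in M. x \<notin> N" by (auto elim!: eventually_mono)
  qed
qed

theorem theorem1p7:
  fixes \<Omega> :: "(real^'n) set" and k :: nat and V :: "real^'n \<Rightarrow> (real^'n) set"
    and \<mu> \<mu>' :: "(real^'n) measure" and \<tau> \<tau>' :: "real^'n \<Rightarrow> 'n list \<Rightarrow> real"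
  assumes "open \<Omega>" and "1 \<le> k" and "k \<le> CARD('n)"
    and "C1_distribution \<Omega> k V"
    and "normal_current_repr \<Omega> k \<mu> \<tau> \<mu>' \<tau>'"
    and "AE x in \<mu>. mvspan k (\<tau> x) = V x"
  shows "(AE x in \<mu>'. mvspan (k - 1) (\<tau>' x) \<subseteq> V x) \<longleftrightarrow> msupp \<mu> \<inter> noninv \<Omega> V = {}"
proof -
  obtain P :: "real^'n \<Rightarrow> real^'n^'n" where P: "C1_on \<Omega> P"
    "\<And>x. x \<in> \<Omega> \<Longrightarrow> \<forall>y. P x *v y \<in> V x \<and> (\<forall>z\<in>V x. orthogonal (y - P x *v y) z)"
    and V: "\<And>x. x \<in> \<Omega> \<Longrightarrow> subspace (V x)" "\<And>x. x \<in> \<Omega> \<Longrightarrow> dim (V x) = k"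
    using assms(4) unfolding C1_distribution_def by blast
  interpret projected_distribution \<Omega> V P
    by unfold_locales (use assms(1) P V in \<open>auto simp: is_proj_def\<close>)
  have M: "sets \<mu> = sets borel" "finite_measure \<mu>" "sets \<mu>' = sets borel" "finite_measure \<mu>'"
    and \<Omega>0: "emeasure \<mu> (UNIV - \<Omega>) = 0" "emeasure \<mu>' (UNIV - \<Omega>) = 0"
    and int: "\<And>l. integrable \<mu> (\<lambda>x. \<tau> x l)" "\<And>l. integrable \<mu>' (\<lambda>x. \<tau>' x l)"
    and mv: "AE x in \<mu>. is_mv k (\<tau> x) \<and> \<tau> x \<noteq> (\<lambda>_. 0)" "AE x in \<mu>'. is_mv (k - 1) (\<tau>' x) \<and> \<tau>' x \<noteq> (\<lambda>_. 0)"
    using assms(5) unfolding normal_current_repr_def finite_measure_on_def by auto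
  have AE_\<Omega>: "AE x in M. x \<in> \<Omega>" if "sets M = sets borel" "emeasure M (UNIV - \<Omega>) = 0" for M :: "(real^'n) measure"
    by (rule AE_I[of _ _ "UNIV - \<Omega>"])
       (use that assms(1) sets_eq_imp_space_eq[OF that(1)] in \<open>auto intro: borel_open\<close>)
  note in\<mu> = AE_\<Omega>[OF M(1) \<Omega>0(1)] and in\<mu>' = AE_\<Omega>[OF M(3) \<Omega>0(2)]
  \<comment> \<open>\<open>G\<close> and \<open>G'\<close> are the densities of the two sides of the
    boundary identity, the contractions of \<open>\<tau>\<close> with d nu and of
    \<open>\<tau>'\<close> with \<open>nu\<close>.\<close>
  define G where "G r q x = (\<Sum>i\<in>UNIV. \<Sum>a\<in>UNIV. dnu r x i a * \<tau> x (i # a # q))" for r q x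
  define G' where "G' r q x = (\<Sum>a\<in>UNIV. nu r x $ a * \<tau>' x (a # q))" for r q x
  have intG: "\<forall>K. compact K \<longrightarrow> K \<subseteq> \<Omega> \<longrightarrow> integrable \<mu> (\<lambda>x. indicator K x * G r q x)" for r q
    unfolding G_def sum_distrib_left
    by (intro allI impI Bochner_Integration.integrable_sum
        integrable_continuous_on_compact_mult[OF M(1) _ continuous_on_subset[OF dnu_continuous] int(1)])
  have intG': "\<forall>K. compact K \<longrightarrow> K \<subseteq> \<Omega> \<longrightarrow> integrable \<mu>' (\<lambda>x. indicator K x * G' r q x)" for r q
    unfolding G'_def sum_distrib_left
    by (intro allI impI Bochner_Integration.integrable_sum
        integrable_continuous_on_compact_mult[OF M(3) _
          continuous_on_subset[OF C1_on_continuous[OF C1_nu_nth]] int(2)])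
  have "AE x in \<mu>. \<forall>r. nu r x \<in> contr (\<tau> x)"
    using mv(1) in\<mu> assms(6)
  proof eventually_elim
    case (elim x)
    then show ?case
      using mvspan_subset_iff_conormal[OF proj, of x k "\<tau> x"] by (simp add: contr_def)
  qed
  note bd = boundary_contraction[OF assms(5,2) this]
  have "AE x in \<mu>'. mvspan (k - 1) (\<tau>' x) \<subseteq> V x \<longleftrightarrow> (\<forall>r q. x \<in> \<Omega> \<longrightarrow> G' r q x = 0)"
    using mv(2) in\<mu>'
  proof eventually_elim
    case (elim x)
    then show ?case using mvspan_subset_iff_conormal[OF proj] by (simp add: G'_def)
  qed
  then have "(AE x in \<mu>'. mvspan (k - 1) (\<tau>' x) \<subseteq> V x)
      \<longleftrightarrow> (AE x in \<mu>'. \<forall>r q. x \<in> \<Omega> \<longrightarrow> G' r q x = 0)"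
    by (rule eventually_subst)
  \<comment> \<open>Indices and lists of indices form countable types, so the null sets for the
    separate \<open>r\<close> and \<open>q\<close> can be united.\<close>
  also have "\<dots> \<longleftrightarrow> (\<forall>r q. AE x in \<mu>'. x \<in> \<Omega> \<longrightarrow> G' r q x = 0)"
    by (simp only: AE_all_countable)
  \<comment> \<open>The passage from \<open>\<mu>'\<close> to \<open>\<mu>\<close>: for fixed
    \<open>r\<close> and \<open>q\<close> the test integrals on both sides coincide, so one family
    vanishes exactly when the other does.\<close>
  also have "\<dots> \<longleftrightarrow> (\<forall>r q. AE x in \<mu>. x \<in> \<Omega> \<longrightarrow> G r q x = 0)"
  proof (intro iff_allI)
    fix r q
    have "(\<integral>x. \<eta> x * G r q x \<partial>\<mu>) = (\<integral>x. \<eta> x * G' r q x \<partial>\<mu>')"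
      if "C1_on UNIV \<eta>" "compact K" "K \<subseteq> \<Omega>" "\<forall>x. x \<notin> K \<longrightarrow> \<eta> x = 0" for \<eta> K
      unfolding G_def G'_def by (rule bd[OF that(1-3)]) (use that(4) in auto)
    then show "(AE x in \<mu>'. x \<in> \<Omega> \<longrightarrow> G' r q x = 0) \<longleftrightarrow> (AE x in \<mu>. x \<in> \<Omega> \<longrightarrow> G r q x = 0)"
      unfolding AE_zero_iff_test[where g = "G' r q", OF M(3,4) assms(1) intG']
        AE_zero_iff_test[where g = "G r q", OF M(1,2) assms(1) intG]
      by (intro iff_allI imp_cong refl) simp
  qed
  also have "\<dots> \<longleftrightarrow> (AE x in \<mu>. \<forall>r q. x \<in> \<Omega> \<longrightarrow> G r q x = 0)"
    by (simp only: AE_all_countable)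
  also have "\<dots> \<longleftrightarrow> (AE x in \<mu>. x \<notin> noninv \<Omega> V)"
  proof (rule eventually_subst)
    show "AE x in \<mu>. (\<forall>r q. x \<in> \<Omega> \<longrightarrow> G r q x = 0) \<longleftrightarrow> x \<notin> noninv \<Omega> V"
      using mv(1) in\<mu> assms(6)
    proof eventually_elim
      case (elim x)
      have "involutive_at \<Omega> V x \<longleftrightarrow> (\<forall>r q. G r q x = 0)"
        unfolding G_def
        by (rule involutive_at_iff_contraction[OF elim(2) _ _ elim(3) V(2)[OF elim(2)]]) (use elim(1) in auto)
      then show ?case using elim(2) by (auto simp: noninv_def)
    qed
  qed
  also have "\<dots> \<longleftrightarrow> msupp \<mu> \<inter> noninv \<Omega> V = {}"
    by (rule AE_notin_iff_msupp_disjoint[OF M(1) open_noninv])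
  finally show ?thesis .
qed

end
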